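(* For a function $\sigma_\hbar:\hbar\mathbb{Z}^n\times\mathbb{T}^n\to\mathbb{C}$ define $\tau_\hbar:\mathbb{T}^n\times\mathbb{Z}^n\to\mathbb{C}$ by $\tau_\hbar(\theta,\bar k):=\overline{\sigma_\hbar(-\hbar\bar k,\theta)}$. Then $$\mathrm{Op}_{\hbar\mathbb{Z}^n}(\sigma_\hbar)=\mathcal{F}_{\hbar\mathbb{Z}^n}^{-1}\circ\mathrm{Op}_{\mathbb{T}^n}(\tau_\hbar)^*\circ\mathcal{F}_{\hbar\mathbb{Z}^n},$$ where $\mathrm{Op}_{\mathbb{T}^n}(\tau_\hbar)^*$ is the adjoint of the toroidal pseudo-differential operator $\mathrm{Op}_{\mathbb{T}^n}(\tau_\hbar)$ (whose symbol depends on the parameter $\hbar$). Moreover, $$\mathrm{Op}_{\mathbb{T}^n}(\tau_\hbar)=\mathcal{F}_{\hbar\mathbb{Z}^n}\circ\mathrm{Op}_{\hbar\mathbb{Z}^n}(\sigma_\hbar)^*\circ\mathcal{F}_{\hbar\mathbb{Z}^n}^{-1},$$ where $\mathrm{Op}_{\hbar\mathbb{Z}^n}(\sigma_\hbar)^*$ is the adjoint of the semi-classical pseudo-differential operator $\mathrm{Op}_{\hbar\mathbb{Z}^n}(\sigma_\hbar)$.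
   Context: Fix $n\ge1$ and $\hbar\in(0,1]$. $\hbar\mathbb{Z}^n=\{\hbar\bar k:\bar k\in\mathbb{Z}^n\}\subset\mathbb{R}^n$, $\mathbb{T}^n=\mathbb{R}^n/\mathbb{Z}^n$, $k\cdot\theta=\sum_jk_j\theta_j$. Semi-classical Fourier transform: $\mathcal{F}_{\hbar\mathbb{Z}^n}f(\theta)=\sum_{k\in\hbar\mathbb{Z}^n}e^{-2\pi\frac{i}{\hbar}k\cdot\theta}f(k)$, with inverse $\mathcal{F}^{-1}_{\hbar\mathbb{Z}^n}u(k)=\int_{\mathbb{T}^n}e^{2\pi\frac{i}{\hbar}k\cdot\theta}u(\theta)\,d\theta$; it is unitary from $\ell^2(\hbar\mathbb{Z}^n)$ onto $L^2(\mathbb{T}^n)$. Toroidal Fourier transform: $\mathcal{F}_{\mathbb{T}^n}u(\bar k)=\int_{\mathbb{T}^n}e^{-2\pi i\theta\cdot\bar k}u(\theta)\,d\theta$, $\bar k\in\mathbb{Z}^n$. Semi-classical quantization: $\mathrm{Op}_{\hbar\mathbb{Z}^n}(\sigma_\hbar)f(k)=\int_{\mathbb{T}^n}e^{2\pi\frac{i}{\hbar}k\cdot\theta}\sigma_\hbar(k,\theta)\,\mathcal{F}_{\hbar\mathbb{Z}^n}f(\theta)\,d\theta$, $k\in\hbar\mathbb{Z}^n$. Toroidal quantization: $\mathrm{Op}_{\mathbb{T}^n}(\tau)u(\theta)=\sum_{\bar k\in\mathbb{Z}^n}e^{2\pi i\theta\cdot\bar k}\tau(\theta,\bar k)\,\mathcal{F}_{\mathbb{T}^n}u(\bar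 k)$, $\theta\in\mathbb{T}^n$. Adjoints are taken with respect to $(f,g)_{\ell^2(\hbar\mathbb{Z}^n)}=\sum_kf(k)\overline{g(k)}$ and $(u,v)_{L^2(\mathbb{T}^n)}=\int_{\mathbb{T}^n}u\bar v\,d\theta$.
   Formalization: Assumes σ_ħ(k,·) is in L²(T^n) for each k, needed for the operators to make sense on L²; the second identity is stated for the closure of Op_T(τ_ħ) (literally when it is bounded), since an adjoint is closed while Op_T(τ_ħ) on its natural L² domain need not be. *)

theory Defs
  imports "HOL-Analysis.Analysis"
begin

section \<open>Operators between \<open>L\<^sup>2\<close> spaces\<close>

text \<open>
  An element of \<open>L\<^sup>2(M)\<close> is represented by any of its representatives, and a (possibly unbounded)
  linear operator by its graph, a set of pairs of representatives. All graphs below are closed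
  under changing either component on a null set, so that equality of sets of pairs is equality of
  the operators, domains included. Operators compose as relations: \<open>A \<circ> B\<close> is \<open>B O A\<close>.
\<close>

definition L2 :: "'a measure \<Rightarrow> ('a \<Rightarrow> complex) set" where
  "L2 M = {f \<in> borel_measurable M. integrable M (\<lambda>x. (cmod (f x))\<^sup>2)}"

definition L2_norm :: "'a measure \<Rightarrow> ('a \<Rightarrow> complex) \<Rightarrow> real" where
  "L2_norm M f = sqrt (LINT x|M. (cmod (f x))\<^sup>2)"

definition L2_inner :: "'a measure \<Rightarrow> ('a \<Rightarrow> complex) \<Rightarrow> ('a \<Rightarrow> complex) \<Rightarrow> complex" where
  "L2_inner M f g = (LINT x|M. f x * cnj (g x))"

text \<open>\<open>v = (\<Sum>a\<in>A. g a)\<close>, the series converging unconditionally in the norm of \<open>L\<^sup>2(M)\<close>.\<close>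

definition L2_has_sum ::
    "'a measure \<Rightarrow> ('i \<Rightarrow> 'a \<Rightarrow> complex) \<Rightarrow> 'i set \<Rightarrow> ('a \<Rightarrow> complex) \<Rightarrow> bool" where
  "L2_has_sum M g A v \<longleftrightarrow> (\<forall>a\<in>A. g a \<in> L2 M) \<and> v \<in> L2 M \<and>
     ((\<lambda>F. L2_norm M (\<lambda>x. v x - (\<Sum>a\<in>F. g a x))) \<longlongrightarrow> 0) (finite_subsets_at_top A)"

type_synonym 'a L2_op = "(('a \<Rightarrow> complex) \<times> ('a \<Rightarrow> complex)) set"

text \<open>
  The Hilbert space adjoint: \<open>v\<close> is in its domain, with value \<open>w\<close>, iff \<open>(R u, v) = (u, w)\<close> for all
  \<open>u\<close> in the domain of \<open>R\<close>. It is single-valued up to null sets iff \<open>R\<close> is densely defined, and is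
  the usual bounded adjoint if \<open>R\<close> is bounded and everywhere defined.
\<close>

definition L2_adjoint :: "'a measure \<Rightarrow> 'a L2_op \<Rightarrow> 'a L2_op" where
  "L2_adjoint M R = {(v, w). v \<in> L2 M \<and> w \<in> L2 M \<and>
     (\<forall>(u, u') \<in> R. L2_inner M u' v = L2_inner M u w)}"

definition L2_closure :: "'a measure \<Rightarrow> 'a L2_op \<Rightarrow> 'a L2_op" where
  "L2_closure M R = {(u, v). u \<in> L2 M \<and> v \<in> L2 M \<and>
     (\<forall>e>0. \<exists>(u', v') \<in> R. L2_norm M (\<lambda>x. u x - u' x) < e \<and> L2_norm M (\<lambda>x. v x - v' x) < e)}"

definition L2_bounded :: "'a measure \<Rightarrow> 'a L2_op \<Rightarrow> bool" where
  "L2_bounded M R \<longleftrightarrow> (\<exists>C. \<forall>(u, v) \<in> R. L2_norm M v \<le> C * L2_norm M u)"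


section \<open>The torus and the lattice\<close>

definition zvec :: "int ^ 'n \<Rightarrow> real ^ 'n" where
  "zvec k = (\<chi> i. of_int (k $ i))"

definition hlattice :: "real \<Rightarrow> (real ^ 'n) set" where
  "hlattice h = range (\<lambda>k :: int ^ 'n. h *\<^sub>R zvec k)"

text \<open>
  \<open>L\<^sup>2\<close> of the following measure is \<open>\<ell>\<^sup>2(h\<int>\<^sup>n)\<close>, with inner product \<open>\<Sum>k. f k * cnj (g k)\<close>; values of
  functions off the lattice are irrelevant.
\<close>

abbreviation lattice_measure :: "real \<Rightarrow> (real ^ 'n) measure" where
  "lattice_measure h \<equiv> count_space (hlattice h)"

text \<open>
  The torus \<open>\<real>\<^sup>n/\<int>\<^sup>n\<close> is represented by its fundamental domain \<open>[0,1)\<^sup>n\<close>, and functions on it by their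
  values there; values outside are irrelevant.
\<close>

definition torus :: "(real ^ 'n) measure" where
  "torus = lebesgue_on {\<theta>. \<forall>i. 0 \<le> \<theta> $ i \<and> \<theta> $ i < 1}"


section \<open>Fourier transforms\<close>

text \<open>
  The graph of the semi-classical Fourier transform on all of \<open>\<ell>\<^sup>2(h\<int>\<^sup>n)\<close>, where its defining series
  converges in \<open>L\<^sup>2\<close> of the torus (for summable \<open>f\<close> also pointwise, to the same function).
\<close>

definition hFourier :: "real \<Rightarrow> (real ^ 'n) L2_op" where
  "hFourier h = {(f, u). f \<in> L2 (lattice_measure h) \<and>
     L2_has_sum torus (\<lambda>k \<theta>. cis (- 2 * pi / h * (k \<bullet> \<theta>)) * f k) (hlattice h) u}"

definition hFourier_inv :: "real \<Rightarrow> (real ^ 'n) L2_op" where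
  "hFourier_inv h = {(u, f). u \<in> L2 torus \<and> f \<in> L2 (lattice_measure h) \<and>
     (\<forall>k \<in> hlattice h. f k = (LINT \<theta>|torus. cis (2 * pi / h * (k \<bullet> \<theta>)) * u \<theta>))}"

definition torus_Fourier :: "(real ^ 'n \<Rightarrow> complex) \<Rightarrow> int ^ 'n \<Rightarrow> complex" where
  "torus_Fourier u k = (LINT \<theta>|torus. cis (- 2 * pi * (\<theta> \<bullet> zvec k)) * u \<theta>)"


section \<open>Quantizations\<close>

text \<open>
  Both operators have their natural domains: all square-integrable arguments for which the
  defining formula makes sense and yields a square-integrable function.
\<close>

definition semiclassical_Op ::
    "real \<Rightarrow> (real ^ 'n \<Rightarrow> real ^ 'n \<Rightarrow> complex) \<Rightarrow> (real ^ 'n) L2_op" where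
  "semiclassical_Op h \<sigma> = {(f, g). g \<in> L2 (lattice_measure h) \<and>
     (\<exists>u. (f, u) \<in> hFourier h \<and>
       (\<forall>k \<in> hlattice h.
          integrable torus (\<lambda>\<theta>. cis (2 * pi / h * (k \<bullet> \<theta>)) * \<sigma> k \<theta> * u \<theta>) \<and>
          g k = (LINT \<theta>|torus. cis (2 * pi / h * (k \<bullet> \<theta>)) * \<sigma> k \<theta> * u \<theta>)))}"

text \<open>As for the Fourier transform, the series is taken in \<open>L\<^sup>2\<close> of the torus. On this
  domain the operator need not be closed (consider \<open>n = 1\<close>,
  \<open>\<tau> \<theta> k = k - (k - 1) * cis (- 2 * pi * \<theta>)\<close> and the argument with Fourier coefficients \<open>1/k\<close>,
  \<open>k \<ge> 1\<close>), whereas adjoints always are; it is closed if it is bounded.\<close>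

definition toroidal_Op ::
    "(real ^ 'n \<Rightarrow> int ^ 'n \<Rightarrow> complex) \<Rightarrow> (real ^ 'n) L2_op" where
  "toroidal_Op \<tau> = {(u, v). u \<in> L2 torus \<and>
     L2_has_sum torus (\<lambda>k \<theta>. cis (2 * pi * (\<theta> \<bullet> zvec k)) * \<tau> \<theta> k * torus_Fourier u k) UNIV v}"

end

theory Submission
  imports Defs
begin

text \<open>
  In the orthonormal basis of exponentials \<open>e\<^sub>k \<theta> = exp (2 \<pi> i k \<cdot> \<theta>)\<close>, put
  \<open>c\<^sub>k = e\<^sub>k \<tau>(\<cdot>, k)\<close>. Then the toroidal operator is \<open>T u = \<Sum>k. (u, e\<^sub>k) c\<^sub>k\<close>, and
  conjugating the semi-classical operator by the (unitary) Fourier transform gives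
  \<open>u \<mapsto> \<Sum>k. (u, c\<^sub>k) e\<^sub>k\<close> on its maximal domain, which is exactly the adjoint of \<open>T\<close>. Taking
  adjoints once more yields \<open>T\<^sup>*\<^sup>*\<close>, the closure of \<open>T\<close>; it equals \<open>T\<close> if \<open>T\<close> is bounded, by
  Bessel's inequality applied to the partial sums.
\<close>

section \<open>Hilbert space structure of \<open>L\<^sup>2\<close>\<close>

text \<open>The condition on the symbol enters as \<open>c k \<in> L2 torus\<close> for every k. It
  puts the trigonometric polynomials into the domain of T, so that testing on the exponentials alone
  determines the adjoint, and it makes each (u, c_k) finite. No bound in k is imposed, so T is in
  general unbounded and the identities are between graphs, domains included. Here the two halves
  separate: an adjoint is always closed, while the domain of T asks for convergence of one
  particular series and need not be complete in the graph norm. The minus sign in the symbol comes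
  from the semi-classical transform: its exponential at the lattice point -h k is e_k, so the value
  of f there is the k-th Fourier coefficient of its transform. Elements of L2 are bare functions
  with a seminorm, so Cauchy-Schwarz, completeness, Riesz-Fischer and nearest points are all
  developed for representatives.\<close>

lemma L2_measurable: "f \<in> L2 M \<Longrightarrow> f \<in> borel_measurable M"
  by (simp add: L2_def)

lemma L2_integrable_sq: "f \<in> L2 M \<Longrightarrow> integrable M (\<lambda>x. (cmod (f x))\<^sup>2)"
  by (simp add: L2_def)

lemma L2I: "f \<in> borel_measurable M \<Longrightarrow> integrable M (\<lambda>x. (cmod (f x))\<^sup>2) \<Longrightarrow> f \<in> L2 M"
  by (simp add: L2_def)

lemma L2_scale: "f \<in> L2 M \<Longrightarrow> (\<lambda>x. c * f x) \<in> L2 M"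
  by (auto simp: L2_def norm_mult power_mult_distrib)

lemma L2_cnj: "f \<in> L2 M \<Longrightarrow> (\<lambda>x. cnj (f x)) \<in> L2 M"
  using borel_measurable_continuous_onI[OF continuous_on_cnj[OF continuous_on_id]]
  by (auto simp: L2_def intro: measurable_compose)

lemma L2_zero: "(\<lambda>x. 0) \<in> L2 M"
  by (simp add: L2_def)

lemma L2_add:
  assumes "f \<in> L2 M" "g \<in> L2 M"
  shows "(\<lambda>x. f x + g x) \<in> L2 M"
proof (rule L2I)
  note [measurable] = L2_measurable[OF assms(1)] L2_measurable[OF assms(2)]
  show "(\<lambda>x. f x + g x) \<in> borel_measurable M" by measurable
  have "integrable M (\<lambda>x. 2 * (cmod (f x))\<^sup>2 + 2 * (cmod (g x))\<^sup>2)"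
    using assms by (intro Bochner_Integration.integrable_add integrable_mult_right L2_integrable_sq)
  then show "integrable M (\<lambda>x. (cmod (f x + g x))\<^sup>2)"
  proof (rule Bochner_Integration.integrable_bound)
    have "(cmod (a + b))\<^sup>2 \<le> 2 * (cmod a)\<^sup>2 + 2 * (cmod b)\<^sup>2" for a b
    proof -
      have "(cmod (a + b))\<^sup>2 \<le> (cmod a + cmod b)\<^sup>2" by (intro power_mono norm_triangle_ineq) auto
      also have "\<dots> \<le> 2 * (cmod a)\<^sup>2 + 2 * (cmod b)\<^sup>2" using sum_squares_bound[of "cmod a" "cmod b"] by (simp add: power2_sum)
      finally show ?thesis .
    qed
    then show "AE x in M. norm ((cmod (f x + g x))\<^sup>2) \<le> norm (2 * (cmod (f x))\<^sup>2 + 2 * (cmod (g x))\<^sup>2)"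
      by auto
  qed measurable
qed

lemma L2_diff: "f \<in> L2 M \<Longrightarrow> g \<in> L2 M \<Longrightarrow> (\<lambda>x. f x - g x) \<in> L2 M"
  using L2_add[of f M "\<lambda>x. -1 * g x"] L2_scale[of g M "-1"] by simp

lemma L2_sum: "(\<And>a. a \<in> F \<Longrightarrow> f a \<in> L2 M) \<Longrightarrow> (\<lambda>x. \<Sum>a\<in>F. f a x) \<in> L2 M"
  by (induction F rule: infinite_finite_induct) (auto simp: L2_zero intro: L2_add)

lemma L2_integrable_mult:
  assumes "f \<in> L2 M" "g \<in> L2 M"
  shows "integrable M (\<lambda>x. f x * g x)"
proof (rule Bochner_Integration.integrable_bound)
  note [measurable] = L2_measurable[OF assms(1)] L2_measurable[OF assms(2)]
  show "integrable M (\<lambda>x. (cmod (f x))\<^sup>2 + (cmod (g x))\<^sup>2)"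
    using assms by (intro Bochner_Integration.integrable_add L2_integrable_sq)
  have "cmod a * cmod b \<le> (cmod a)\<^sup>2 + (cmod b)\<^sup>2" for a b
    proof -
    have "2 * (cmod a * cmod b) \<le> (cmod a)\<^sup>2 + (cmod b)\<^sup>2" "0 \<le> cmod a * cmod b"
      using sum_squares_bound[of "cmod a" "cmod b"] by simp_all
    then show ?thesis by linarith
  qed
  then show "AE x in M. norm (f x * g x) \<le> norm ((cmod (f x))\<^sup>2 + (cmod (g x))\<^sup>2)"
    by (simp add: norm_mult)
  show "(\<lambda>x. f x * g x) \<in> borel_measurable M" by measurable
qed

lemma L2_integrable_mult_cnj: "f \<in> L2 M \<Longrightarrow> g \<in> L2 M \<Longrightarrow> integrable M (\<lambda>x. f x * cnj (g x))"
  by (intro L2_integrable_mult L2_cnj)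

lemma L2_norm_nonneg [simp]: "0 \<le> L2_norm M f"
  by (simp add: L2_norm_def)

lemma L2_norm_power2: "(L2_norm M f)\<^sup>2 = (LINT x|M. (cmod (f x))\<^sup>2)"
  by (simp add: L2_norm_def)

lemma L2_inner_self: "L2_inner M f f = of_real ((L2_norm M f)\<^sup>2)"
  by (simp add: L2_inner_def L2_norm_power2 complex_norm_square[symmetric] flip: of_real_power integral_complex_of_real)

lemma L2_inner_commute: "L2_inner M g f = cnj (L2_inner M f g)"
proof -
  have "cnj (LINT x|M. f x * cnj (g x)) = (LINT x|M. cnj (f x * cnj (g x)))"
    by (rule Bochner_Integration.integral_cnj[symmetric])
  then show ?thesis by (simp add: L2_inner_def mult.commute)
qed

lemma L2_inner_add_left:
  "f \<in> L2 M \<Longrightarrow> f' \<in> L2 M \<Longrightarrow> g \<in> L2 M \<Longrightarrow>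
    L2_inner M (\<lambda>x. f x + f' x) g = L2_inner M f g + L2_inner M f' g"
  by (simp add: L2_inner_def distrib_right L2_integrable_mult_cnj)

lemma L2_inner_diff_left:
  "f \<in> L2 M \<Longrightarrow> f' \<in> L2 M \<Longrightarrow> g \<in> L2 M \<Longrightarrow>
    L2_inner M (\<lambda>x. f x - f' x) g = L2_inner M f g - L2_inner M f' g"
  by (simp add: L2_inner_def left_diff_distrib L2_integrable_mult_cnj)

lemma L2_inner_scale_left: "L2_inner M (\<lambda>x. c * f x) g = c * L2_inner M f g"
  by (simp add: L2_inner_def mult.assoc)

lemma L2_inner_sum_left:
  assumes "\<And>a. a \<in> F \<Longrightarrow> f a \<in> L2 M" "g \<in> L2 M"
  shows "L2_inner M (\<lambda>x. \<Sum>a\<in>F. f a x) g = (\<Sum>a\<in>F. L2_inner M (f a) g)"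
  using assms by (simp add: L2_inner_def sum_distrib_right L2_integrable_mult_cnj)

lemma L2_inner_add_right:
  "f \<in> L2 M \<Longrightarrow> g \<in> L2 M \<Longrightarrow> g' \<in> L2 M \<Longrightarrow>
    L2_inner M f (\<lambda>x. g x + g' x) = L2_inner M f g + L2_inner M f g'"
  by (simp add: L2_inner_commute[of M f] L2_inner_add_left)

lemma L2_inner_diff_right:
  "f \<in> L2 M \<Longrightarrow> g \<in> L2 M \<Longrightarrow> g' \<in> L2 M \<Longrightarrow>
    L2_inner M f (\<lambda>x. g x - g' x) = L2_inner M f g - L2_inner M f g'"
  by (simp add: L2_inner_commute[of M f] L2_inner_diff_left)

lemma L2_inner_scale_right: "L2_inner M f (\<lambda>x. c * g x) = cnj c * L2_inner M f g"
  by (simp add: L2_inner_commute[of M f] L2_inner_scale_left)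

lemma L2_norm_scale: "L2_norm M (\<lambda>x. c * f x) = cmod c * L2_norm M f"
  by (simp add: L2_norm_def norm_mult power_mult_distrib real_sqrt_mult)

lemma L2_norm_minus_commute: "L2_norm M (\<lambda>x. f x - g x) = L2_norm M (\<lambda>x. g x - f x)"
  by (simp add: L2_norm_def norm_minus_commute)

lemma L2_norm_add_power2:
  assumes "f \<in> L2 M" "g \<in> L2 M"
  shows "(L2_norm M (\<lambda>x. f x + g x))\<^sup>2 =
    (L2_norm M f)\<^sup>2 + (L2_norm M g)\<^sup>2 + 2 * Re (L2_inner M f g)"
proof -
  have "of_real ((L2_norm M (\<lambda>x. f x + g x))\<^sup>2) = L2_inner M f f + L2_inner M g g + (L2_inner M f g + cnj (L2_inner M f g))"
    unfolding L2_inner_self[symmetric]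
    by (simp add: L2_inner_add_left L2_inner_add_right L2_add assms L2_inner_commute[of M g f])
  then show ?thesis
    unfolding L2_inner_self complex_add_cnj by (simp only: of_real_eq_iff flip: of_real_add)
qed

lemma L2_norm_diff_power2:
  assumes "f \<in> L2 M" "g \<in> L2 M"
  shows "(L2_norm M (\<lambda>x. f x - g x))\<^sup>2 =
    (L2_norm M f)\<^sup>2 + (L2_norm M g)\<^sup>2 - 2 * Re (L2_inner M f g)"
  using L2_norm_add_power2[OF assms(1) L2_scale[OF assms(2), of "-1"]]
    L2_norm_scale[of M "-1" g] L2_inner_scale_right[of M f "-1" g]
  by simp

lemma L2_norm_Cauchy_Schwarz:
  assumes f: "f \<in> L2 M" and g: "g \<in> L2 M"
  shows "cmod (L2_inner M f g) \<le> L2_norm M f * L2_norm M g"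
proof (cases "L2_norm M g = 0")
  case False
  define z where "z = L2_inner M f g"
  define G where "G = (L2_norm M g)\<^sup>2"
  have G: "G > 0" using False by (simp add: G_def)
  \<comment> \<open>The coefficient of the orthogonal projection of \<open>f\<close> onto the span
    of \<open>g\<close>: with it the squared norm of \<open>f - c g\<close> is that of
    \<open>f\<close> minus \<open>(cmod z)^2 / G\<close>.\<close>
  define c where "c = z / of_real G"
  have c: "Re (cnj c * z) = (cmod z)\<^sup>2 / G"
    using cmod_power2[of z]
    by (simp add: c_def Re_divide_of_real Im_divide_of_real power2_eq_square add_divide_distrib)
  have cc: "cmod c = cmod z / G" using G by (simp add: c_def norm_divide)
  have "0 \<le> (L2_norm M (\<lambda>x. f x - c * g x))\<^sup>2" by simp
  also have "\<dots> = (L2_norm M f)\<^sup>2 + (cmod z / G)\<^sup>2 * G - 2 * ((cmod z)\<^sup>2 / G)"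
    unfolding L2_norm_diff_power2[OF f L2_scale[OF g]] L2_norm_scale L2_inner_scale_right z_def[symmetric] c
    using G by (simp add: cc power_mult_distrib power_divide flip: G_def)
  also have "\<dots> = (L2_norm M f)\<^sup>2 - (cmod z)\<^sup>2 / G"
    using G by (simp add: power2_eq_square)
  finally have "(cmod z)\<^sup>2 \<le> (L2_norm M f * L2_norm M g)\<^sup>2"
    using G by (simp add: field_simps power_mult_distrib flip: G_def)
  then show ?thesis
    unfolding z_def by (rule power2_le_imp_le) simp
next
  case True
  \<comment> \<open>Norm zero only makes \<open>g\<close> vanish almost everywhere, which is enough
    for the integral of the product.\<close>
  have "(LINT x|M. (cmod (g x))\<^sup>2) = 0" using True L2_norm_power2[of M g] by simp
  then have "AE x in M. g x = 0"
    using integral_nonneg_eq_0_iff_AE[OF L2_integrable_sq[OF g]] by simp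
  then have "L2_inner M f g = 0"
    unfolding L2_inner_def by (intro integral_eq_zero_AE) auto
  then show ?thesis by simp
qed

lemma L2_norm_triangle:
  assumes "f \<in> L2 M" "g \<in> L2 M"
  shows "L2_norm M (\<lambda>x. f x + g x) \<le> L2_norm M f + L2_norm M g"
proof (rule power2_le_imp_le)
  have "Re (L2_inner M f g) \<le> L2_norm M f * L2_norm M g"
    using complex_Re_le_cmod L2_norm_Cauchy_Schwarz[OF assms] order_trans by blast
  then show "(L2_norm M (\<lambda>x. f x + g x))\<^sup>2 \<le> (L2_norm M f + L2_norm M g)\<^sup>2"
    unfolding L2_norm_add_power2[OF assms] by (simp add: power2_sum)
qed simp

lemma L2_norm_diff_triangle:
  assumes "f \<in> L2 M" "g \<in> L2 M" "k \<in> L2 M"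
  shows "L2_norm M (\<lambda>x. f x - k x) \<le> L2_norm M (\<lambda>x. f x - g x) + L2_norm M (\<lambda>x. g x - k x)"
  using L2_norm_triangle[OF L2_diff[OF assms(1,2)] L2_diff[OF assms(2,3)]] by simp

lemma L2_norm_cong_AE:
  assumes "f \<in> L2 M" "g \<in> L2 M" "AE x in M. f x = g x"
  shows "L2_norm M f = L2_norm M g"
  unfolding L2_norm_def using assms
  by (intro arg_cong[where f=sqrt] integral_cong_AE) (auto dest: L2_measurable)

text \<open>Continuity of the inner product, by Cauchy-Schwarz. The filter is arbitrary because it
  will be applied along finite index sets, not along sequences.\<close>

lemma L2_inner_tendsto_left:
  assumes lim: "((\<lambda>i. L2_norm M (\<lambda>x. f i x - g x)) \<longlongrightarrow> 0) F"
    and f: "\<And>i. f i \<in> L2 M" and g: "g \<in> L2 M" and w: "w \<in> L2 M"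
  shows "((\<lambda>i. L2_inner M (f i) w) \<longlongrightarrow> L2_inner M g w) F"
proof -
  have "((\<lambda>i. L2_inner M (f i) w - L2_inner M g w) \<longlongrightarrow> 0) F"
  proof (rule Lim_null_comparison)
    show "\<forall>\<^sub>F i in F. norm (L2_inner M (f i) w - L2_inner M g w) \<le> L2_norm M (\<lambda>x. f i x - g x) * L2_norm M w"
      using L2_norm_Cauchy_Schwarz[OF L2_diff[OF f g] w] by (simp add: L2_inner_diff_left f g w)
    show "((\<lambda>i. L2_norm M (\<lambda>x. f i x - g x) * L2_norm M w) \<longlongrightarrow> 0) F"
      using tendsto_mult_right[OF lim, of "L2_norm M w"] by simp
  qed
  then show ?thesis by (simp add: LIM_zero_iff)
qed

lemma nn_integral_L2_norm:
  "f \<in> L2 M \<Longrightarrow> (\<integral>\<^sup>+x. ennreal ((cmod (f x))\<^sup>2) \<partial>M) = ennreal ((L2_norm M f)\<^sup>2)"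
  by (simp add: L2_norm_power2 nn_integral_eq_integral L2_integrable_sq)

section \<open>Completeness of L2 over a finite measure\<close>

lemma (in finite_measure) L2_const: "(\<lambda>x. c) \<in> L2 M"
  by (simp add: L2_def)

text \<open>Cauchy-Schwarz against the constant 1: finiteness of the measure embeds L2 into L1. In
  the completeness proof this turns summable L2 increments into an almost everywhere convergent
  series.\<close>

lemma (in finite_measure) L2_nn_integral_norm_le:
  assumes "f \<in> L2 M"
  shows "(\<integral>\<^sup>+x. ennreal (cmod (f x)) \<partial>M) \<le> ennreal (sqrt (measure M (space M)) * L2_norm M f)"
proof -
  have f': "(\<lambda>x. of_real (cmod (f x))) \<in> L2 M"
    using assms by (auto simp: L2_def)
  have int: "integrable M (\<lambda>x. cmod (f x))"
    using integrable_norm[OF L2_integrable_mult_cnj[OF f' L2_const[of 1]]] by simp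
  have "L2_inner M (\<lambda>x. of_real (cmod (f x))) (\<lambda>x. 1) = of_real (LINT x|M. cmod (f x))"
    by (simp add: L2_inner_def)
  then have "(LINT x|M. cmod (f x)) \<le> cmod (L2_inner M (\<lambda>x. of_real (cmod (f x))) (\<lambda>x. 1))"
    by simp
  also have "\<dots> \<le> sqrt (measure M (space M)) * L2_norm M f"
    using L2_norm_Cauchy_Schwarz[OF f' L2_const[of 1]] by (simp add: L2_norm_def mult.commute)
  finally show ?thesis
    using int by (simp add: nn_integral_eq_integral)
qed

text \<open>A subsequence with geometrically small steps converges almost everywhere, and Fatou's
  lemma carries the Cauchy estimates of the whole sequence over to that limit.\<close>

lemma (in finite_measure) L2_complete:
  assumes f: "\<And>n. f n \<in> L2 M"
    and cauchy: "\<And>e. e > 0 \<Longrightarrow> \<exists>N. \<forall>m\<ge>N. \<forall>n\<ge>N. L2_norm M (\<lambda>x. f m x - f n x) < e"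
  obtains g where "g \<in> L2 M" "(\<lambda>n. L2_norm M (\<lambda>x. f n x - g x)) \<longlonglongrightarrow> 0"
proof -
  note [measurable] = L2_measurable[OF f]
  have "\<forall>k. \<exists>N. \<forall>m\<ge>N. \<forall>n\<ge>N. L2_norm M (\<lambda>x. f m x - f n x) < (1/2)^k"
    using cauchy by simp
  then obtain N where N: "\<And>k m n. m \<ge> N k \<Longrightarrow> n \<ge> N k \<Longrightarrow> L2_norm M (\<lambda>x. f m x - f n x) < (1/2)^k"
    by metis
  \<comment> \<open>Partial sums of \<open>N\<close> dominate every earlier threshold, so
    \<open>r n\<close> and \<open>r (Suc n)\<close> both lie past \<open>N n\<close> and the step
    \<open>d n\<close> has norm below \<open>(1/2)^n\<close>.\<close>
  define r where "r n = (\<Sum>i\<le>n. N i)" for n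
  have r: "k \<le> n \<Longrightarrow> N k \<le> r n" for k n
    unfolding r_def by (intro member_le_sum) auto
  define d where "d n x = f (r (Suc n)) x - f (r n) x" for n x
  have d: "d n \<in> L2 M" for n unfolding d_def by (intro L2_diff f)
  note [measurable] = L2_measurable[OF d]
  have "(\<integral>\<^sup>+x. (\<Sum>n. ennreal (cmod (d n x))) \<partial>M) = (\<Sum>n. \<integral>\<^sup>+x. ennreal (cmod (d n x)) \<partial>M)"
    by (rule nn_integral_suminf) measurable
  also have "\<dots> \<le> (\<Sum>n. ennreal (sqrt (measure M (space M)) * (1/2)^n))"
  proof (rule suminf_le)
    fix n
    have "L2_norm M (d n) \<le> (1/2)^n"
      unfolding d_def using N[of n "r (Suc n)" "r n"] r by (simp add: less_imp_le)
    then have "sqrt (measure M (space M)) * L2_norm M (d n) \<le> sqrt (measure M (space M)) * (1/2)^n"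
      by (intro mult_left_mono) auto
    then show "(\<integral>\<^sup>+x. ennreal (cmod (d n x)) \<partial>M) \<le> ennreal (sqrt (measure M (space M)) * (1/2)^n)"
      using L2_nn_integral_norm_le[OF d, of n] by (meson ennreal_leI order_trans)
  qed auto
  also have "\<dots> = ennreal (\<Sum>n. sqrt (measure M (space M)) * (1/2)^n)"
    by (intro suminf_ennreal2 summable_mult) auto
  also have "\<dots> < \<infinity>" by simp
  finally have "(\<integral>\<^sup>+x. (\<Sum>n. ennreal (cmod (d n x))) \<partial>M) \<noteq> \<infinity>" by simp
  then have "AE x in M. (\<Sum>n. ennreal (cmod (d n x))) \<noteq> \<infinity>"
    by (intro nn_integral_PInf_AE) measurable
  then have conv: "AE x in M. (\<lambda>n. f (r n) x) \<longlonglongrightarrow> lim (\<lambda>n. f (r n) x)"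
  proof eventually_elim
    case (elim x)
    then have "summable (\<lambda>n. cmod (d n x))"
      by (intro summable_suminf_not_top) auto
    then have "summable (\<lambda>n. d n x)"
      by (rule summable_norm_cancel)
    then have "convergent (\<lambda>n. \<Sum>i<n. d i x)"
      by (simp add: summable_iff_convergent)
    then have "convergent (\<lambda>n. f (r 0) x + (\<Sum>i<n. d i x))"
      by (intro convergent_add convergent_const)
    moreover have "(\<lambda>n. f (r 0) x + (\<Sum>i<n. d i x)) = (\<lambda>n. f (r n) x)"
      using sum_lessThan_telescope[of "\<lambda>n. f (r n) x"] by (simp add: d_def)
    ultimately have "convergent (\<lambda>n. f (r n) x)"
      by metis
    then show ?case
      by (simp add: convergent_LIMSEQ_iff)
  qed
  define g where "g x = lim (\<lambda>n. f (r n) x)" for x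
  have [measurable]: "g \<in> borel_measurable M"
    unfolding g_def by (rule borel_measurable_lim_metric) measurable
  \<comment> \<open>The index \<open>m\<close> stays fixed while the subsequence index tends to
    infinity; this bounds the full sequence, not only the subsequence.\<close>
  have fatou: "(\<integral>\<^sup>+x. ennreal ((cmod (f m x - g x))\<^sup>2) \<partial>M) \<le> ennreal (((1/2)^k)\<^sup>2)" if m: "m \<ge> N k" for m k
  proof -
    have "(\<integral>\<^sup>+x. ennreal ((cmod (f m x - g x))\<^sup>2) \<partial>M)
        = (\<integral>\<^sup>+x. liminf (\<lambda>n. ennreal ((cmod (f m x - f (r n) x))\<^sup>2)) \<partial>M)"
    proof (rule nn_integral_cong_AE, use conv in eventually_elim)
      fix x assume "(\<lambda>n. f (r n) x) \<longlonglongrightarrow> lim (\<lambda>n. f (r n) x)"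
      then have "(\<lambda>n. ennreal ((cmod (f m x - f (r n) x))\<^sup>2)) \<longlonglongrightarrow> ennreal ((cmod (f m x - g x))\<^sup>2)"
        unfolding g_def by (intro tendsto_ennrealI tendsto_intros)
      then show "ennreal ((cmod (f m x - g x))\<^sup>2) = liminf (\<lambda>n. ennreal ((cmod (f m x - f (r n) x))\<^sup>2))"
        by (rule lim_imp_Liminf[symmetric, rotated]) simp
    qed
    also have "\<dots> \<le> liminf (\<lambda>n. \<integral>\<^sup>+x. ennreal ((cmod (f m x - f (r n) x))\<^sup>2) \<partial>M)"
      by (rule nn_integral_liminf) measurable
    also have "\<dots> \<le> ennreal (((1/2)^k)\<^sup>2)"
    proof (rule Liminf_le)
      show "\<forall>\<^sub>F n in sequentially. (\<integral>\<^sup>+x. ennreal ((cmod (f m x - f (r n) x))\<^sup>2) \<partial>M) \<le> ennreal (((1/2)^k)\<^sup>2)"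
        using eventually_ge_at_top[of k]
      proof eventually_elim
        case (elim n)
        have "L2_norm M (\<lambda>x. f m x - f (r n) x) \<le> (1/2)^k"
          using N[OF m, of "r n"] r[OF elim] by simp
        then show ?case
          unfolding nn_integral_L2_norm[OF L2_diff[OF f f]] by (intro ennreal_leI power_mono) auto
      qed
    qed simp
    finally show ?thesis .
  qed
  have diff: "(\<lambda>x. f m x - g x) \<in> L2 M" if "m \<ge> N 0" for m
  proof (rule L2I)
    show "integrable M (\<lambda>x. (cmod (f m x - g x))\<^sup>2)"
    proof (rule integrableI_bounded)
      have "(\<integral>\<^sup>+x. ennreal (norm ((cmod (f m x - g x))\<^sup>2)) \<partial>M) \<le> ennreal (((1/2)^0)\<^sup>2)"
        using fatou[OF that] by simp
      also have "\<dots> < \<infinity>" by simp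
      finally show "(\<integral>\<^sup>+x. ennreal (norm ((cmod (f m x - g x))\<^sup>2)) \<partial>M) < \<infinity>" .
    qed measurable
  qed measurable
  have g: "g \<in> L2 M"
    using L2_diff[OF f diff[OF order_refl], of "N 0"] by simp
  have "L2_norm M (\<lambda>x. f m x - g x) \<le> (1/2)^k" if "m \<ge> N k" for m k
  proof (rule power2_le_imp_le)
    show "(L2_norm M (\<lambda>x. f m x - g x))\<^sup>2 \<le> ((1/2)^k)\<^sup>2"
      using fatou[OF that] unfolding nn_integral_L2_norm[OF L2_diff[OF f g]] by simp
  qed simp
  have "\<exists>k. (1/2)^k < e" if "e > 0" for e :: real
    using real_arch_pow_inv[OF that, of "1/2"] by simp
  have "(\<lambda>n. L2_norm M (\<lambda>x. f n x - g x)) \<longlonglongrightarrow> 0"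
  proof (intro LIMSEQ_I)
    fix e :: real assume "e > 0"
    then obtain k where "(1/2)^k < e" using \<open>\<And>e :: real. e > 0 \<Longrightarrow> \<exists>k. (1/2)^k < e\<close> by blast
    then show "\<exists>no. \<forall>n\<ge>no. norm (L2_norm M (\<lambda>x. f n x - g x) - 0) < e"
      using \<open>\<And>m k. m \<ge> N k \<Longrightarrow> L2_norm M (\<lambda>x. f m x - g x) \<le> (1/2)^k\<close>
      by (intro exI[of _ "N k"]) (auto intro: le_less_trans)
  qed
  with g show ?thesis by (rule that)
qed

section \<open>Orthonormality of the exponentials\<close>

lemma zvec_add: "zvec (k + l) = zvec k + zvec l"
  and zvec_minus: "zvec (- k) = - zvec k"
  and zvec_zero [simp]: "zvec 0 = 0"
  by (simp_all add: zvec_def vec_eq_iff)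

lemma zvec_eq_iff [simp]: "zvec k = zvec l \<longleftrightarrow> k = l"
  by (simp add: zvec_def vec_eq_iff)

definition torus_exp :: "int ^ 'n \<Rightarrow> real ^ 'n \<Rightarrow> complex" where
  "torus_exp k \<theta> = cis (2 * pi * (\<theta> \<bullet> zvec k))"

lemma torus_exp_add: "torus_exp (k + l) \<theta> = torus_exp k \<theta> * torus_exp l \<theta>"
  by (simp add: torus_exp_def zvec_add inner_add_right distrib_left cis_mult)

lemma cnj_torus_exp: "cnj (torus_exp k \<theta>) = torus_exp (- k) \<theta>"
  by (simp add: torus_exp_def zvec_minus cis_cnj)

lemma norm_torus_exp [simp]: "cmod (torus_exp k \<theta>) = 1"
  by (simp add: torus_exp_def)

lemma torus_exp_zero [simp]: "torus_exp 0 \<theta> = 1"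
  by (simp add: torus_exp_def)

lemma continuous_on_torus_exp [continuous_intros]: "continuous_on S (torus_exp k)"
  unfolding torus_exp_def by (intro continuous_intros)

lemma space_torus: "space torus = {\<theta>. \<forall>i. 0 \<le> \<theta> $ i \<and> \<theta> $ i < 1}"
  by (simp add: torus_def)

lemma torus_borel: "{\<theta> :: real ^ 'n. \<forall>i. 0 \<le> \<theta> $ i \<and> \<theta> $ i < 1} \<in> sets borel"
  by measurable

lemma space_torus_lebesgue: "space torus \<in> sets lebesgue"
  unfolding space_torus using torus_borel by auto

lemma torus_eq: "torus = lebesgue_on (space torus)"
  by (simp add: torus_def)

lemma torus_subset_cbox: "(space torus :: (real ^ 'n) set) \<subseteq> cbox 0 1"
  by (auto simp: space_torus mem_box_cart less_imp_le)

lemma finite_measure_torus: "finite_measure (torus :: (real ^ 'n) measure)"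
proof (rule finite_measureI)
  have "emeasure torus (space (torus :: (real ^ 'n) measure)) = emeasure lebesgue (space (torus :: (real ^ 'n) measure))"
    by (subst torus_eq, subst emeasure_restrict_space)
       (use space_torus_lebesgue in auto)
  also have "\<dots> \<le> emeasure lebesgue (cbox 0 (1 :: real ^ 'n))"
    by (intro emeasure_mono torus_subset_cbox) auto
  also have "\<dots> < \<infinity>"
    using emeasure_lborel_cbox_finite by (simp add: emeasure_completion)
  finally show "emeasure torus (space (torus :: (real ^ 'n) measure)) \<noteq> \<infinity>"
    by simp
qed

interpretation torus: finite_measure torus
  by (rule finite_measure_torus)

lemma borel_measurable_torus: "f \<in> borel_measurable borel \<Longrightarrow> f \<in> borel_measurable torus"
  unfolding torus_def by (rule measurable_restrict_space1) (simp add: measurable_completion)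

lemma torus_exp_measurable [measurable]: "torus_exp k \<in> borel_measurable torus"
  by (intro borel_measurable_torus borel_measurable_continuous_onI continuous_intros)

lemma torus_exp_L2: "torus_exp k \<in> L2 torus"
  by (simp add: L2_def)

lemma integral_cis_unit_interval:
  "(LINT t|lborel. indicator {0..<1} t *\<^sub>R cis (2 * pi * of_int m * t)) = of_bool (m = 0)"
proof -
  \<comment> \<open>The torus uses the half-open interval, the fundamental theorem of calculus the
    closed one; they differ by a null point.\<close>
  have "AE t in lborel. t \<noteq> (1::real)"
    by (rule AE_lborel_singleton)
  then have ae: "AE t in lborel. indicator {0..<1} t *\<^sub>R cis (2 * pi * of_int m * t)
      = indicator {0..1} t *\<^sub>R cis (2 * pi * of_int m * t)"
    by eventually_elim (auto simp: indicator_def)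
  have meas: "(\<lambda>t. cis (2 * pi * of_int m * t)) \<in> borel_measurable borel"
    by (intro borel_measurable_continuous_onI continuous_intros)
  have "(LINT t|lborel. indicator {0..<1} t *\<^sub>R cis (2 * pi * of_int m * t))
      = (LINT t|lborel. indicator {0..1} t *\<^sub>R cis (2 * pi * of_int m * t))"
    using meas by (intro integral_cong_AE ae) simp_all
  also have "\<dots> = of_bool (m = 0)"
  proof (cases "m = 0")
    case False
    define c where "c = \<i> * of_real (2 * pi * of_int m)"
    have c: "c \<noteq> 0" using False by (simp add: c_def)
    define F where "F t = exp (c * of_real t) / c" for t :: real
    have exp_c: "cis (2 * pi * of_int m * t) = exp (c * of_real t)" for t
      by (simp add: c_def cis_conv_exp mult_ac)
    have "(LINT t|lborel. indicator {0..1} t *\<^sub>R exp (c * of_real t)) = F 1 - F 0"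
    proof (rule integral_FTC_atLeastAtMost)
      fix x :: real
      have "((\<lambda>z. exp (c * z) / c) has_field_derivative exp (c * of_real x)) (at (of_real x))"
        using c by (auto intro!: derivative_eq_intros)
      then show "(F has_vector_derivative exp (c * of_real x)) (at x within {0..1})"
        unfolding F_def by (rule has_vector_derivative_real_field)
    qed (auto intro!: continuous_intros)
    also have "F 1 = F 0"
      using cis_multiple_2pi[of "of_int m"] exp_c[of 1] by (simp add: F_def)
    finally show ?thesis using False by (simp add: exp_c)
  qed simp
  finally show ?thesis .
qed

text \<open>The torus carries completed Lebesgue measure, while the decomposition into a product is
  that of \<open>lborel\<close>. For Borel integrands completion does not change the
  integral.\<close>

lemma integral_torus_eq_lborel:
  fixes f :: "real ^ 'n \<Rightarrow> complex"
  assumes "f \<in> borel_measurable borel"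
  shows "(LINT \<theta>|torus. f \<theta>) = (LINT \<theta>|lborel. indicator (space torus) \<theta> *\<^sub>R f \<theta>)"
proof -
  have "(LINT \<theta>|torus. f \<theta>) = (LINT \<theta>|lebesgue. indicator (space torus) \<theta> *\<^sub>R f \<theta>)"
    by (subst torus_eq, subst integral_restrict_space) (simp_all add: space_torus_lebesgue)
  also have "\<dots> = (LINT \<theta>|lborel. indicator (space torus) \<theta> *\<^sub>R f \<theta>)"
    using assms torus_borel by (intro integral_completion) (auto simp: space_torus)
  finally show ?thesis .
qed

lemma prod_Basis_cart:
  fixes g :: "real ^ 'n \<Rightarrow> 'a :: comm_monoid_mult"
  shows "(\<Prod>b\<in>Basis. g b) = (\<Prod>i\<in>UNIV. g (axis i 1))"
proof -
  have Basis: "(Basis :: (real ^ 'n) set) = range (\<lambda>i. axis i 1)"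
    by (auto simp: Basis_vec_def)
  have "inj (\<lambda>i :: 'n. axis i (1::real))"
    by (simp add: inj_on_def axis_eq_axis)
  then show ?thesis
    unfolding Basis by (simp add: prod.reindex)
qed

lemma cis_sum: "finite A \<Longrightarrow> cis (\<Sum>i\<in>A. f i) = (\<Prod>i\<in>A. cis (f i))"
  by (induction A rule: finite_induct) (auto simp flip: cis_mult)

text \<open>Indicator and exponential both factor over the coordinates, so the integral is a product
  of one-dimensional ones, and one of these vanishes as soon as some \<open>k $ i\<close> is
  nonzero.\<close>

lemma integral_torus_exp: "(LINT \<theta>|torus. torus_exp k \<theta>) = of_bool (k = 0)"
proof -
  define f where "f b t = indicator {0..<1} t *\<^sub>R cis (2 * pi * (zvec k \<bullet> b) * t)" for b t
  interpret P: product_sigma_finite "\<lambda>b :: real ^ 'n. lborel :: real measure"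
    by standard
  have f_meas [measurable]: "f b \<in> borel_measurable borel" for b
  proof -
    have "(\<lambda>t. cis (2 * pi * (zvec k \<bullet> b) * t)) \<in> borel_measurable borel"
      by (intro borel_measurable_continuous_onI continuous_intros)
    then show ?thesis unfolding f_def by measurable
  qed
  have f_int: "integrable lborel (f b)" for b
  proof -
    have "integrable lborel (indicator {0..<1::real} :: real \<Rightarrow> real)"
      by (subst integrable_indicator_iff) auto
    then show ?thesis
      by (rule Bochner_Integration.integrable_bound) (auto simp: f_def)
  qed
  have split: "indicator (space torus) \<theta> *\<^sub>R torus_exp k \<theta> = (\<Prod>b\<in>Basis. f b (\<theta> \<bullet> b))" for \<theta>
  proof -
    have "(\<Prod>b\<in>Basis. f b (\<theta> \<bullet> b)) =
        of_real (\<Prod>i\<in>UNIV. indicator {0..<1} (\<theta> $ i)) * (\<Prod>i\<in>UNIV. cis (2 * pi * of_int (k $ i) * \<theta> $ i))"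
      by (simp add: prod_Basis_cart f_def inner_axis zvec_def scaleR_conv_of_real prod.distrib)
    also have "(\<Prod>i\<in>UNIV. cis (2 * pi * of_int (k $ i) * \<theta> $ i)) = torus_exp k \<theta>"
      by (simp add: torus_exp_def zvec_def inner_vec_def sum_distrib_left mult_ac flip: cis_sum)
    also have "(\<Prod>i\<in>UNIV. indicator {0..<1} (\<theta> $ i)) = (indicator (space torus) \<theta> :: real)"
      by (auto simp: space_torus indicator_def prod_zero_iff not_le not_less intro!: prod.neutral)
    finally show ?thesis by (simp add: scaleR_conv_of_real)
  qed
  have one: "(LINT t|lborel. f (axis i 1) t) = of_bool (k $ i = 0)" for i
    using integral_cis_unit_interval[of "k $ i"] by (simp add: f_def inner_axis zvec_def)
  have "(LINT \<theta>|torus. torus_exp k \<theta>) = (LINT \<theta>|lborel. (\<Prod>b\<in>Basis. f b (\<theta> \<bullet> b)))"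
    by (subst integral_torus_eq_lborel)
       (auto simp: split intro!: borel_measurable_continuous_onI continuous_intros)
  also have "\<dots> = (LINT x|(\<Pi>\<^sub>M b\<in>Basis. lborel). (\<Prod>b\<in>Basis. f b ((\<Sum>b'\<in>Basis. x b' *\<^sub>R b') \<bullet> b)))"
    by (subst lborel_eq, subst integral_distr) auto
  also have "\<dots> = (LINT x|(\<Pi>\<^sub>M b\<in>Basis. lborel). (\<Prod>b\<in>Basis. f b (x b)))"
    by (intro Bochner_Integration.integral_cong refl prod.cong) simp_all
  also have "\<dots> = (\<Prod>b\<in>Basis. LINT t|lborel. f b t)"
    by (intro P.product_integral_prod f_int finite_Basis)
  also have "\<dots> = (\<Prod>i\<in>UNIV. of_bool (k $ i = 0))"
    by (simp add: prod_Basis_cart one)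
  also have "\<dots> = of_bool (k = 0)"
    by (auto simp: vec_eq_iff prod_zero_iff)
  finally show ?thesis .
qed

lemma torus_exp_orthonormal: "L2_inner torus (torus_exp k) (torus_exp l) = of_bool (k = l)"
  using integral_torus_exp[of "k + - l"] by (simp add: L2_inner_def cnj_torus_exp flip: torus_exp_add)

section \<open>Completeness of the exponentials\<close>

text \<open>Generated by monomials and sums only, so that a statement linear in the polynomial
  follows by induction; closure under products, needed for Stone-Weierstrass, is derived.\<close>

inductive trig_poly :: "(real ^ 'n \<Rightarrow> complex) \<Rightarrow> bool" where
  monomial: "trig_poly (\<lambda>\<theta>. c * torus_exp k \<theta>)"
| add: "trig_poly p \<Longrightarrow> trig_poly q \<Longrightarrow> trig_poly (\<lambda>\<theta>. p \<theta> + q \<theta>)"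

lemma trig_poly_term_mult:
  assumes "trig_poly q"
  shows "trig_poly (\<lambda>\<theta>. c * torus_exp k \<theta> * q \<theta>)"
  using assms
proof induction
  case (monomial d l)
  have "trig_poly (\<lambda>\<theta>. (c * d) * torus_exp (k + l) \<theta>)" by (rule trig_poly.monomial)
  then show ?case by (simp add: torus_exp_add mult_ac)
next
  case (add p q)
  then show ?case by (auto simp: distrib_left intro: trig_poly.add)
qed

lemma trig_poly_mult:
  assumes "trig_poly p" "trig_poly q"
  shows "trig_poly (\<lambda>\<theta>. p \<theta> * q \<theta>)"
  using assms(1)
proof induction
  case (monomial c k)
  show ?case by (rule trig_poly_term_mult) fact
next
  case (add p p')
  then show ?case by (auto simp: distrib_right intro: trig_poly.add)
qed

lemma trig_poly_const: "trig_poly (\<lambda>\<theta>. c)"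
  using trig_poly.monomial[of c 0] by simp

lemma trig_poly_sum: "(\<And>a. a \<in> A \<Longrightarrow> trig_poly (p a)) \<Longrightarrow> trig_poly (\<lambda>\<theta>. \<Sum>a\<in>A. p a \<theta>)"
  by (induction A rule: infinite_finite_induct) (auto intro: trig_poly.add trig_poly_const)

lemma trig_poly_bounded: "trig_poly p \<Longrightarrow> \<exists>B. \<forall>\<theta>. cmod (p \<theta>) \<le> B"
proof (induction rule: trig_poly.induct)
  case (monomial c k)
  then show ?case by (auto simp: norm_mult)
next
  case (add p q)
  then obtain B B' where "\<And>\<theta>. cmod (p \<theta>) \<le> B" "\<And>\<theta>. cmod (q \<theta>) \<le> B'" by blast
  then show ?case by (intro exI[of _ "B + B'"] allI norm_triangle_mono)
qed

text \<open>The standard embedding of the torus as a product of unit circles. On the closed unit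
  cube it identifies opposite faces, and real polynomials on the target pull back to trigonometric
  polynomials, which makes Stone-Weierstrass applicable.\<close>

definition torus_embed :: "real ^ 'n \<Rightarrow> complex ^ 'n" where
  "torus_embed \<theta> = (\<chi> i. cis (2 * pi * \<theta> $ i))"

lemma continuous_on_torus_embed: "continuous_on S torus_embed"
  unfolding torus_embed_def
  by (intro continuous_on_vec_lambda continuous_intros)

lemma torus_exp_axis: "torus_exp (axis i m) \<theta> = cis (2 * pi * of_int m * \<theta> $ i)"
proof -
  have "zvec (axis i m) = axis i (of_int m)"
    by (simp add: zvec_def axis_def vec_eq_iff)
  then show ?thesis by (simp add: torus_exp_def inner_axis mult_ac)
qed

lemma trig_poly_real_polynomial:
  fixes g :: "complex ^ 'n \<Rightarrow> real"
  assumes "real_polynomial_function g"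
  shows "trig_poly (\<lambda>\<theta>. of_real (g (torus_embed \<theta>)))"
  using assms
proof induction
  case (linear g)
  \<comment> \<open>The real inner product of complex numbers \<open>z\<close> and \<open>u\<close>
    is \<open>(cnj u * z + u * cnj z) / 2\<close>, and conjugating \<open>cis\<close> flips the sign
    of the frequency.\<close>
  have inner_eq: "complex_of_real (cis (2 * pi * \<theta> $ i) \<bullet> u) =
      cnj u / 2 * torus_exp (axis i 1) \<theta> + u / 2 * torus_exp (axis i (-1)) \<theta>" for \<theta> :: "real ^ 'n" and i u
    by (simp add: torus_exp_axis inner_complex_def complex_eq_iff field_simps)
  have "trig_poly (\<lambda>\<theta>. complex_of_real (torus_embed \<theta> \<bullet> b))" if b_Basis: "b \<in> Basis" for b :: "complex ^ 'n"
  proof -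
    obtain i u where b: "b = axis i u"
      using b_Basis unfolding Basis_vec_def by blast
    show ?thesis
      unfolding b inner_axis torus_embed_def vec_lambda_beta inner_eq
      by (intro trig_poly.add trig_poly.monomial)
  qed
  then have sum: "trig_poly (\<lambda>\<theta>. \<Sum>b\<in>Basis. of_real (torus_embed \<theta> \<bullet> b) * of_real (g b))"
    by (intro trig_poly_sum trig_poly_mult trig_poly_const)
  have "g x = (\<Sum>b\<in>Basis. (x \<bullet> b) * g b)" for x
  proof -
    interpret bounded_linear g by fact
    have "g x = g (\<Sum>b\<in>Basis. (x \<bullet> b) *\<^sub>R b)" by (simp add: euclidean_representation)
    also have "\<dots> = (\<Sum>b\<in>Basis. (x \<bullet> b) * g b)"
      unfolding sum scaleR real_scaleR_def ..
    finally show ?thesis .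
  qed
  then have "complex_of_real (g (torus_embed \<theta>)) = (\<Sum>b\<in>Basis. of_real (torus_embed \<theta> \<bullet> b) * of_real (g b))" for \<theta>
    by (metis (no_types, lifting) of_real_mult of_real_sum sum.cong)
  with sum show ?case by simp
next
  case (const c)
  then show ?case by (rule trig_poly_const)
next
  case (add f g)
  then show ?case by (simp only: of_real_add) (rule trig_poly.add)
next
  case (mult f g)
  then show ?case by (simp only: of_real_mult) (rule trig_poly_mult)
qed

text \<open>Points with equal image differ by an integer vector. Within the closed cube a coordinate
  in which they differ must be 0 for one and 1 for the other, which puts both on the
  boundary.\<close>

lemma torus_embed_eqD:
  assumes "torus_embed x = torus_embed y" "x \<in> cbox 0 1" "y \<in> cbox 0 1"
  shows "x = y \<or> (x \<notin> box 0 1 \<and> y \<notin> box 0 1)"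
proof (cases "x = y")
  case False
  then obtain i where i: "x $ i \<noteq> y $ i" by (auto simp: vec_eq_iff)
  have "cis (2 * pi * x $ i) = cis (2 * pi * y $ i)"
    using assms(1) by (simp add: torus_embed_def vec_eq_iff)
  then have "sin (2 * pi * x $ i) = sin (2 * pi * y $ i) \<and> cos (2 * pi * x $ i) = cos (2 * pi * y $ i)"
    by (simp add: complex_eq_iff)
  then obtain n where n: "2 * pi * x $ i = 2 * pi * y $ i + 2 * pi * of_int n"
    using sin_cos_eq_iff by blast
  have "2 * pi * (x $ i - y $ i - of_int n) = 0"
    using n by (simp add: algebra_simps)
  then have n': "x $ i = y $ i + of_int n" by simp
  have bounds: "0 \<le> x $ i" "x $ i \<le> 1" "0 \<le> y $ i" "y $ i \<le> 1"
    using assms(2,3) by (auto simp: mem_box_cart)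
  have "n \<noteq> 0" using n' i by auto
  then have "of_int n \<ge> (1::real) \<or> of_int n \<le> (-1::real)" by linarith
  then have "(x $ i = 0 \<and> y $ i = 1) \<or> (x $ i = 1 \<and> y $ i = 0)"
    using n' bounds by linarith
  then show ?thesis
    by (auto simp: mem_box_cart intro!: exI[of _ i])
qed simp

text \<open>Vanishing on the boundary makes \<phi> constant on the fibres of
  \<open>torus_embed\<close>, so it descends to the compact image, where Stone-Weierstrass applies;
  pulling the polynomial back gives \<open>p\<close>.\<close>

lemma trig_poly_approx:
  fixes \<phi> :: "real ^ 'n \<Rightarrow> real"
  assumes cont: "continuous_on (cbox 0 1) \<phi>" and zero: "\<And>x. x \<in> cbox 0 1 - box 0 1 \<Longrightarrow> \<phi> x = 0"
    and "0 < e"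
  obtains p where "trig_poly p" "\<And>x. x \<in> cbox 0 1 \<Longrightarrow> cmod (of_real (\<phi> x) - p x) < e"
proof -
  define Q where "Q = cbox 0 (1 :: real ^ 'n)"
  define S where "S = torus_embed ` Q"
  define \<psi> where "\<psi> z = \<phi> (SOME x. x \<in> Q \<and> torus_embed x = z)" for z
  have \<psi>: "\<psi> (torus_embed x) = \<phi> x" if "x \<in> Q" for x
  proof -
    define y where "y = (SOME y. y \<in> Q \<and> torus_embed y = torus_embed x)"
    have "y \<in> Q \<and> torus_embed y = torus_embed x"
      unfolding y_def by (rule someI[of _ x]) (use that in simp)
    then have "\<phi> y = \<phi> x"
      using torus_embed_eqD[of y x] that zero by (auto simp: Q_def)
    then show ?thesis by (simp add: \<psi>_def y_def)
  qed
  have "compact S"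
    unfolding S_def Q_def by (intro compact_continuous_image continuous_on_torus_embed compact_cbox)
  moreover have "continuous_on S \<psi>"
    \<comment> \<open>A continuous map from a compact set onto its Hausdorff image is a quotient
      map, so openness in \<open>S\<close> may be checked on preimages in the cube.\<close>
    unfolding continuous_openin_preimage_eq
  proof (intro allI impI)
    fix U :: "real set" assume "open U"
    have "Q \<inter> torus_embed -` (S \<inter> \<psi> -` U) = Q \<inter> \<phi> -` U"
    proof (intro set_eqI)
      fix x show "x \<in> Q \<inter> torus_embed -` (S \<inter> \<psi> -` U) \<longleftrightarrow> x \<in> Q \<inter> \<phi> -` U"
        using \<psi>[of x] by (cases "x \<in> Q") (simp_all add: S_def)
    qed
    moreover have "openin (top_of_set Q) (Q \<inter> \<phi> -` U)"
      using cont \<open>open U\<close> unfolding Q_def continuous_openin_preimage_eq by blast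
    ultimately show "openin (top_of_set S) (S \<inter> \<psi> -` U)"
      using Abstract_Topology_2.continuous_imp_quotient_map[of Q torus_embed S "S \<inter> \<psi> -` U"]
      by (simp add: continuous_on_torus_embed S_def Q_def compact_cbox)
  qed
  ultimately obtain g where g: "real_polynomial_function g" "\<And>z. z \<in> S \<Longrightarrow> \<bar>\<psi> z - g z\<bar> < e"
    using Stone_Weierstrass_real_polynomial_function[OF _ _ \<open>0 < e\<close>] by blast
  have "cmod (of_real (\<phi> x) - of_real (g (torus_embed x))) < e" if "x \<in> Q" for x
  proof -
    have "\<bar>\<phi> x - g (torus_embed x)\<bar> < e"
      using g(2)[of "torus_embed x"] \<psi>[OF that] that by (simp add: S_def)
    then show ?thesis by (simp flip: of_real_diff)
  qed
  then show ?thesis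
    using that[OF trig_poly_real_polynomial[OF g(1)]] by (simp add: Q_def)
qed

section \<open>Integrable functions with vanishing Fourier coefficients\<close>

lemma integrable_torus_mult_bounded:
  assumes w: "integrable torus w" and p: "p \<in> borel_measurable torus" and B: "\<And>x. x \<in> space torus \<Longrightarrow> cmod (p x) \<le> B"
  shows "integrable torus (\<lambda>x. p x * w x :: complex)"
proof (rule Bochner_Integration.integrable_bound)
  show "integrable torus (\<lambda>x. of_real B * w x)" using w by simp
  show "(\<lambda>x. p x * w x) \<in> borel_measurable torus" using w p by measurable
  show "AE x in torus. norm (p x * w x) \<le> norm (of_real B * w x)"
    by (intro AE_I2) (use B in \<open>auto simp: norm_mult intro!: mult_right_mono order_trans[OF _ abs_ge_self]\<close>)
qed

lemma trig_poly_measurable: "trig_poly p \<Longrightarrow> p \<in> borel_measurable torus"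
  by (induction rule: trig_poly.induct) auto

lemma integrable_trig_poly_mult:
  assumes "integrable torus w" "trig_poly p"
  shows "integrable torus (\<lambda>\<theta>. p \<theta> * w \<theta>)"
proof -
  obtain B where "\<And>\<theta>. cmod (p \<theta>) \<le> B"
    using trig_poly_bounded[OF assms(2)] by blast
  then show ?thesis
    by (rule integrable_torus_mult_bounded[OF assms(1) trig_poly_measurable[OF assms(2)]])
qed

lemma trig_poly_integral_eq_0:
  assumes w: "integrable torus w" and hat: "\<And>k. torus_Fourier w k = 0" and p: "trig_poly p"
  shows "(LINT \<theta>|torus. p \<theta> * w \<theta>) = 0"
  using p
proof induction
  case (monomial c k)
  have "torus_exp k \<theta> = cis (- 2 * pi * (\<theta> \<bullet> zvec (- k)))" for \<theta> :: "real ^ 'a"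
    by (simp add: torus_exp_def zvec_minus)
  then show ?case
    using hat[of "- k"] by (simp add: torus_Fourier_def mult.assoc)
next
  case (add p q)
  have "integrable torus (\<lambda>\<theta>. p \<theta> * w \<theta>)" "integrable torus (\<lambda>\<theta>. q \<theta> * w \<theta>)"
    by (rule integrable_trig_poly_mult[OF w]; fact)+
  then show ?case by (simp add: distrib_right add.IH)
qed

text \<open>Replacing \<phi> by a uniformly close trigonometric polynomial costs at most
  \<open>e\<close> times the L1 norm of \<open>w\<close>, and the polynomial itself integrates to 0
  against \<open>w\<close>.\<close>

lemma integral_mult_continuous_eq_0:
  fixes \<phi> :: "real ^ 'n \<Rightarrow> real"
  assumes w: "integrable torus w" and hat: "\<And>k. torus_Fourier w k = 0"
    and cont: "continuous_on UNIV \<phi>" and zero: "\<And>x. x \<in> cbox 0 1 - box 0 1 \<Longrightarrow> \<phi> x = 0"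
  shows "(LINT \<theta>|torus. of_real (\<phi> \<theta>) * w \<theta>) = 0"
proof -
  define C where "C = (LINT \<theta>|torus. cmod (w \<theta>))"
  have C: "C \<ge> 0" by (simp add: C_def)
  have cont': "continuous_on (cbox 0 1) \<phi>" by (rule continuous_on_subset[OF cont]) simp
  have "compact (\<phi> ` cbox 0 1)"
    by (intro compact_continuous_image cont' compact_cbox)
  then obtain B where B: "\<And>x. x \<in> cbox 0 1 \<Longrightarrow> \<bar>\<phi> x\<bar> \<le> B"
    by (metis compact_imp_bounded bounded_iff image_eqI real_norm_def)
  have "(\<lambda>\<theta>. complex_of_real (\<phi> \<theta>)) \<in> borel_measurable torus"
    by (intro borel_measurable_torus borel_measurable_continuous_onI continuous_intros cont)
  then have int: "integrable torus (\<lambda>\<theta>. of_real (\<phi> \<theta>) * w \<theta>)"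
    using B torus_subset_cbox by (intro integrable_torus_mult_bounded[OF w, of _ B]) auto
  have bound: "cmod (LINT \<theta>|torus. of_real (\<phi> \<theta>) * w \<theta>) \<le> e * C" if "e > 0" for e
  proof -
    obtain p where p: "trig_poly p" "\<And>x. x \<in> cbox 0 1 \<Longrightarrow> cmod (of_real (\<phi> x) - p x) < e"
      using trig_poly_approx[OF cont' zero \<open>e > 0\<close>] by blast
    have pint: "integrable torus (\<lambda>\<theta>. p \<theta> * w \<theta>)"
      by (rule integrable_trig_poly_mult[OF w p(1)])
    have "(LINT \<theta>|torus. of_real (\<phi> \<theta>) * w \<theta>) = (LINT \<theta>|torus. of_real (\<phi> \<theta>) * w \<theta> - p \<theta> * w \<theta>)"
      using int pint trig_poly_integral_eq_0[OF w hat p(1)] by simp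
    also have "cmod \<dots> \<le> (LINT \<theta>|torus. cmod (of_real (\<phi> \<theta>) * w \<theta> - p \<theta> * w \<theta>))"
      by (rule integral_norm_bound)
    also have "\<dots> \<le> (LINT \<theta>|torus. e * cmod (w \<theta>))"
    proof (rule integral_mono)
      fix x assume "x \<in> space (torus :: (real ^ 'n) measure)"
      then have "cmod (of_real (\<phi> x) - p x) \<le> e"
        using p(2) torus_subset_cbox by (meson less_imp_le subsetD)
      then show "cmod (of_real (\<phi> x) * w x - p x * w x) \<le> e * cmod (w x)"
        by (simp add: norm_mult mult_right_mono flip: left_diff_distrib)
    qed (use int pint w in auto)
    also have "\<dots> = e * C" by (simp add: C_def)
    finally show ?thesis .
  qed
  have "cmod (LINT \<theta>|torus. of_real (\<phi> \<theta>) * w \<theta>) \<le> 0 + e" if "e > 0" for e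
  proof -
    \<comment> \<open>Dividing by \<open>C + 1\<close> instead of \<open>C\<close> covers the case
      \<open>C = 0\<close>.\<close>
    have "e / (C + 1) * C \<le> e" using C that by (simp add: field_simps)
    then show ?thesis using bound[of "e / (C + 1)"] C that by simp
  qed
  then show ?thesis
    using field_le_epsilon[of "cmod (LINT \<theta>|torus. of_real (\<phi> \<theta>) * w \<theta>)" 0] by simp
qed

lemma integral_open_eq_0:
  fixes U :: "(real ^ 'n) set"
  assumes w: "integrable torus w" and hat: "\<And>k. torus_Fourier w k = 0"
    and U: "open U" "U \<subseteq> box 0 1"
  shows "(LINT \<theta>|torus. indicator U \<theta> *\<^sub>R w \<theta>) = 0"
proof -
  \<comment> \<open>Truncated multiples of the distance to the complement of \<open>U\<close>:
    continuous, zero outside \<open>U\<close> and in particular on the boundary of the cube, and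
    increasing pointwise to the indicator of \<open>U\<close>.\<close>
  define \<phi> where "\<phi> j \<theta> = min 1 (real j * infdist \<theta> (- U))" for j \<theta>
  have "bounded U" using bounded_subset[OF bounded_box U(2)] .
  \<comment> \<open>The distance to the empty set is 0 by convention, so positivity of the distance
    inside \<open>U\<close> requires a nonempty complement.\<close>
  then have ne: "- U \<noteq> {}" by (metis boolean_algebra.compl_zero double_complement not_bounded_UNIV)
  have cl: "closed (- U)" using U(1) by auto
  have cont: "continuous_on UNIV (\<phi> j)" for j
    unfolding \<phi>_def by (intro continuous_intros continuous_on_infdist)
  have "(LINT \<theta>|torus. of_real (\<phi> j \<theta>) * w \<theta>) = 0" for j
  proof (rule integral_mult_continuous_eq_0[OF w hat cont])
    fix x :: "real ^ 'n" assume "x \<in> cbox 0 1 - box 0 1"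
    then have "x \<in> - U" using U(2) by blast
    then show "\<phi> j x = 0" by (simp add: \<phi>_def)
  qed
  moreover have "(\<lambda>j. LINT \<theta>|torus. of_real (\<phi> j \<theta>) * w \<theta>) \<longlonglongrightarrow> (LINT \<theta>|torus. indicator U \<theta> *\<^sub>R w \<theta>)"
  proof (rule integral_dominated_convergence)
    have [measurable]: "U \<in> sets borel" using U(1) by simp
    have [measurable]: "w \<in> borel_measurable torus" using w by simp
    have "(indicator U :: _ \<Rightarrow> real) \<in> borel_measurable torus"
      by (rule borel_measurable_torus) measurable
    then show "(\<lambda>\<theta>. indicator U \<theta> *\<^sub>R w \<theta>) \<in> borel_measurable torus" by measurable
    have [measurable]: "(\<lambda>\<theta>. complex_of_real (\<phi> j \<theta>)) \<in> borel_measurable torus" for j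
      by (intro borel_measurable_torus borel_measurable_continuous_onI continuous_intros cont)
    show "(\<lambda>\<theta>. of_real (\<phi> j \<theta>) * w \<theta>) \<in> borel_measurable torus" for j by measurable
    show "integrable torus (\<lambda>\<theta>. cmod (w \<theta>))" using w by simp
    show "AE \<theta> in torus. norm (of_real (\<phi> j \<theta>) * w \<theta>) \<le> cmod (w \<theta>)" for j
    proof (intro AE_I2)
      fix \<theta>
      have "\<bar>\<phi> j \<theta>\<bar> \<le> 1" by (simp add: \<phi>_def infdist_nonneg)
      then show "norm (of_real (\<phi> j \<theta>) * w \<theta>) \<le> cmod (w \<theta>)"
        using mult_right_mono[of "\<bar>\<phi> j \<theta>\<bar>" 1 "cmod (w \<theta>)"] by (simp add: norm_mult)
    qed
    show "AE \<theta> in torus. (\<lambda>j. of_real (\<phi> j \<theta>) * w \<theta>) \<longlonglongrightarrow> indicator U \<theta> *\<^sub>R w \<theta>"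
    proof (intro AE_I2)
      fix \<theta>
      have "(\<lambda>j. \<phi> j \<theta>) \<longlonglongrightarrow> indicator U \<theta>"
      proof (cases "\<theta> \<in> U")
        case True
        then have pos: "infdist \<theta> (- U) > 0"
          by (intro infdist_pos_not_in_closed cl ne) simp
        obtain J where J: "1 / infdist \<theta> (- U) \<le> real J"
          using real_arch_simple by blast
        have "\<phi> j \<theta> = 1" if "j \<ge> J" for j
        proof -
          have "1 / infdist \<theta> (- U) \<le> real j" using J that by simp
          then have "1 \<le> real j * infdist \<theta> (- U)" using pos by (simp add: field_simps)
          then show ?thesis by (simp add: \<phi>_def)
        qed
        then have "\<forall>\<^sub>F j in sequentially. \<phi> j \<theta> = 1"
          unfolding eventually_sequentially by blast
        then show ?thesis using True by (simp add: tendsto_eventually)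
      qed (simp add: \<phi>_def)
      then have "(\<lambda>j. of_real (\<phi> j \<theta>) * w \<theta>) \<longlonglongrightarrow> of_real (indicator U \<theta>) * w \<theta>"
        by (intro tendsto_intros)
      then show "(\<lambda>j. of_real (\<phi> j \<theta>) * w \<theta>) \<longlonglongrightarrow> indicator U \<theta> *\<^sub>R w \<theta>"
        by (simp only: scaleR_conv_of_real)
    qed
  qed
  ultimately show ?thesis
    by (simp add: LIMSEQ_const_iff)
qed

text \<open>Lebesgue differentiation recovers \<open>w\<close> from its vanishing integrals over small boxes.\<close>

lemma torus_Fourier_unique:
  fixes w :: "real ^ 'n \<Rightarrow> complex"
  assumes w: "integrable torus w" and hat: "\<And>k. torus_Fourier w k = 0"
  shows "AE \<theta> in torus. w \<theta> = 0"
proof -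
  define Q where "Q = (space torus :: (real ^ 'n) set)"
  \<comment> \<open>Extension by zero, since the differentiation theorem concerns functions on the
    whole space.\<close>
  define f where "f \<theta> = indicator Q \<theta> *\<^sub>R w \<theta>" for \<theta>
  have Q: "Q \<in> sets lebesgue" unfolding Q_def by (rule space_torus_lebesgue)
  have torus: "torus = lebesgue_on Q" unfolding Q_def by (rule torus_eq)
  have f: "integrable lebesgue f"
    using w Q unfolding f_def torus by (subst (asm) integrable_restrict_space) auto
  have int_on: "integrable (lebesgue_on S) f" if "S \<in> sets lebesgue" for S
    using f that by (subst integrable_restrict_space) (auto intro: integrable_mult_indicator)
  have "f integrable_on cbox a b" for a b
    by (intro integrable_on_lebesgue_on int_on) auto
  then obtain N where N: "negligible N"
    "\<And>x e. \<lbrakk>x \<notin> N; 0 < e\<rbrakk> \<Longrightarrow> \<exists>d>0. \<forall>h. 0 < h \<and> h < d \<longrightarrow>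
      norm (integral (cbox x (x + h *\<^sub>R One)) f /\<^sub>R h ^ DIM(real ^ 'n) - f x) < e"
    using integrable_ccontinuous_explicit[of f] by blast
  have zero: "f x = 0" if x: "x \<in> box 0 1" "x \<notin> N" for x
  proof -
    obtain r where r: "r > 0" "ball x r \<subseteq> box 0 1"
      using open_contains_ball[of "box 0 (1 :: real ^ 'n)"] x(1) by auto
    have "norm (f x) < e" if e: "e > 0" for e
    proof -
      obtain d where d: "d > 0" "\<And>h. 0 < h \<Longrightarrow> h < d \<Longrightarrow>
          norm (integral (cbox x (x + h *\<^sub>R One)) f /\<^sub>R h ^ DIM(real ^ 'n) - f x) < e"
        using N(2)[OF x(2) e] by blast
      define D where "D = norm (One :: real ^ 'n) + 1"
      have D: "D > 0" by (simp add: D_def add_nonneg_pos)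
      \<comment> \<open>Small enough for the differentiation estimate and for the cube of side
        \<open>h\<close> at \<open>x\<close> to stay in the ball of radius \<open>r\<close>:
        \<open>h * D\<close> bounds its diameter. The 1 in \<open>D\<close> makes \<open>D\<close>
        visibly positive.\<close>
      define h where "h = min (d / 2) (r / (2 * D))"
      have h: "0 < h" "h < d" "h * D < r"
      proof -
        show "0 < h" "h < d" using d(1) r(1) D by (auto simp: h_def)
        have "h * D \<le> r / (2 * D) * D" using D by (intro mult_right_mono) (auto simp: h_def)
        also have "\<dots> < r" using D r(1) by simp
        finally show "h * D < r" .
      qed
      let ?B = "box x (x + h *\<^sub>R One)"
      have "?B \<subseteq> ball x r"
      proof
        fix y assume "y \<in> ?B"
        then have y: "\<bar>(y - x) \<bullet> b\<bar> \<le> \<bar>(h *\<^sub>R One) \<bullet> b\<bar>" if "b \<in> Basis" for b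
          using that h(1) by (auto simp: mem_box inner_simps inner_sum_left_Basis dest!: bspec[of _ _ b])
        have "norm (y - x) \<le> norm (h *\<^sub>R One :: real ^ 'n)"
          by (rule norm_le_componentwise) (rule y)
        also have "\<dots> < r" using h by (simp add: D_def algebra_simps)
        finally show "y \<in> ball x r" by (simp add: dist_norm norm_minus_commute)
      qed
      then have B: "?B \<subseteq> box 0 1" using r(2) by blast
      have "integral (cbox x (x + h *\<^sub>R One)) f = integral ?B f"
        by (rule integral_open_interval[symmetric])
      also have "\<dots> = (LINT \<theta>|lebesgue_on ?B. f \<theta>)"
        by (intro lebesgue_integral_eq_integral[symmetric] int_on) auto
      also have "\<dots> = (LINT \<theta>|lebesgue. indicator Q \<theta> *\<^sub>R indicator ?B \<theta> *\<^sub>R w \<theta>)"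
        by (subst integral_restrict_space) (auto simp: f_def mult_ac)
      also have "\<dots> = (LINT \<theta>|torus. indicator ?B \<theta> *\<^sub>R w \<theta>)"
        unfolding torus using Q by (subst integral_restrict_space) auto
      also have "\<dots> = 0"
        by (rule integral_open_eq_0[OF w hat _ B]) (rule open_box)
      finally show ?thesis using d(2)[OF h(1,2)] by simp
    qed
    then show ?thesis by (metis less_irrefl zero_less_norm_iff)
  qed
  have "negligible (N \<union> (cbox 0 1 - box 0 (1 :: real ^ 'n)))"
    using N(1) negligible_frontier_interval[of 0 "1 :: real ^ 'n"] by (rule negligible_Un)
  then have "AE x in lebesgue. x \<notin> N \<union> (cbox 0 1 - box 0 (1 :: real ^ 'n))"
    unfolding negligible_iff_null_sets by (rule AE_not_in)
  then have "AE x in lebesgue. x \<in> Q \<longrightarrow> w x = 0"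
  proof eventually_elim
    case (elim x)
    have "w x = 0" if "x \<in> Q"
      using zero[of x] elim that torus_subset_cbox by (auto simp: f_def Q_def)
    then show ?case by blast
  qed
  then show ?thesis
    unfolding torus using Q by (subst AE_restrict_space_iff) auto
qed

section \<open>Fourier series in \<open>L\<^sup>2\<close> of the torus\<close>

lemma torus_Fourier_eq_inner: "torus_Fourier u k = L2_inner torus u (torus_exp k)"
  by (simp add: torus_Fourier_def L2_inner_def torus_exp_def cis_cnj mult.commute)

lemma torus_Fourier_diff:
  "u \<in> L2 torus \<Longrightarrow> v \<in> L2 torus \<Longrightarrow>
    torus_Fourier (\<lambda>\<theta>. u \<theta> - v \<theta>) k = torus_Fourier u k - torus_Fourier v k"
  by (simp add: torus_Fourier_eq_inner L2_inner_diff_left torus_exp_L2)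

definition trig_sum :: "(int ^ 'n \<Rightarrow> complex) \<Rightarrow> (int ^ 'n) set \<Rightarrow> real ^ 'n \<Rightarrow> complex" where
  "trig_sum a F \<theta> = (\<Sum>k\<in>F. torus_exp k \<theta> * a k)"

lemma torus_exp_scale_L2: "(\<lambda>\<theta>. torus_exp k \<theta> * c) \<in> L2 torus"
  using L2_scale[OF torus_exp_L2, of c k] by (simp add: mult.commute)

lemma trig_sum_L2: "trig_sum a F \<in> L2 torus"
  unfolding trig_sum_def by (intro L2_sum torus_exp_scale_L2)

lemma trig_sum_inner:
  assumes "v \<in> L2 torus"
  shows "L2_inner torus (trig_sum a F) v = (\<Sum>k\<in>F. a k * cnj (torus_Fourier v k))"
proof -
  have "L2_inner torus (\<lambda>\<theta>. torus_exp k \<theta> * a k) v = a k * cnj (torus_Fourier v k)" for k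
    using L2_inner_scale_left[of torus "a k" "torus_exp k" v]
    by (simp add: torus_Fourier_eq_inner L2_inner_commute[of torus "torus_exp k"] mult.commute)
  then show ?thesis
    unfolding trig_sum_def using assms by (subst L2_inner_sum_left) (simp_all add: torus_exp_scale_L2)
qed

lemma torus_Fourier_trig_sum:
  assumes "finite F"
  shows "torus_Fourier (trig_sum a F) k = (if k \<in> F then a k else 0)"
proof -
  have "a l * cnj (torus_Fourier (torus_exp k) l) = (if l = k then a k else 0)" for l
    by (simp add: torus_Fourier_eq_inner torus_exp_orthonormal)
  then show ?thesis
    using assms by (simp add: torus_Fourier_eq_inner[of "trig_sum a F"] trig_sum_inner torus_exp_L2)
qed

lemma trig_sum_norm:
  assumes "finite F"
  shows "(L2_norm torus (trig_sum a F))\<^sup>2 = (\<Sum>k\<in>F. (cmod (a k))\<^sup>2)"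
proof -
  have "complex_of_real ((L2_norm torus (trig_sum a F))\<^sup>2) = (\<Sum>k\<in>F. a k * cnj (a k))"
    unfolding L2_inner_self[symmetric] trig_sum_inner[OF trig_sum_L2]
    using assms by (intro sum.cong) (simp_all add: torus_Fourier_trig_sum)
  also have "\<dots> = complex_of_real (\<Sum>k\<in>F. (cmod (a k))\<^sup>2)"
    by (simp only: complex_norm_square[symmetric] of_real_sum)
  finally show ?thesis by (simp only: of_real_eq_iff)
qed

text \<open>Expand the squared norm of \<open>u - s\<close> for the partial Fourier sum
  \<open>s\<close>: the inner product of \<open>s\<close> with \<open>u\<close> and the squared norm
  of \<open>s\<close> are both the sum on the left.\<close>

lemma Bessel_inequality:
  assumes u: "u \<in> L2 torus" and F: "finite F"
  shows "(\<Sum>k\<in>F. (cmod (torus_Fourier u k))\<^sup>2) \<le> (L2_norm torus u)\<^sup>2"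
proof -
  define s where "s = trig_sum (torus_Fourier u) F"
  have "L2_inner torus s u = of_real (\<Sum>k\<in>F. (cmod (torus_Fourier u k))\<^sup>2)"
    unfolding s_def trig_sum_inner[OF u] by (simp only: complex_norm_square[symmetric] of_real_sum)
  then have "Re (L2_inner torus u s) = (\<Sum>k\<in>F. (cmod (torus_Fourier u k))\<^sup>2)"
    by (simp add: L2_inner_commute[of torus u])
  then have "(L2_norm torus (\<lambda>\<theta>. u \<theta> - s \<theta>))\<^sup>2 = (L2_norm torus u)\<^sup>2 - (\<Sum>k\<in>F. (cmod (torus_Fourier u k))\<^sup>2)"
    unfolding L2_norm_diff_power2[OF u trig_sum_L2[of "torus_Fourier u" F, folded s_def]]
    by (simp add: s_def trig_sum_norm[OF F])
  then show ?thesis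
    by (metis diff_ge_0_iff_ge zero_le_power2)
qed

lemma torus_Fourier_summable:
  assumes "u \<in> L2 torus"
  shows "(\<lambda>k. (cmod (torus_Fourier u k))\<^sup>2) summable_on UNIV"
  by (rule nonneg_bdd_above_summable_on)
     (auto intro!: bdd_aboveI[of _ "(L2_norm torus u)\<^sup>2"] Bessel_inequality assms)

text \<open>Take \<open>F\<close> with sum within \<open>e\<close> of the total; the terms being
  nonnegative, a disjoint finite set has to fit into the remaining gap.\<close>

lemma summable_on_small_tail:
  fixes f :: "'a \<Rightarrow> real"
  assumes f: "f summable_on UNIV" and nonneg: "\<And>x. f x \<ge> 0" and "e > 0"
  shows "\<exists>F. finite F \<and> (\<forall>G. finite G \<longrightarrow> G \<inter> F = {} \<longrightarrow> sum f G < e)"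
proof -
  have "(sum f \<longlongrightarrow> infsum f UNIV) (finite_subsets_at_top UNIV)"
    using has_sum_infsum[OF f] by (simp add: has_sum_def)
  then have "\<forall>\<^sub>F F in finite_subsets_at_top UNIV. sum f F > infsum f UNIV - e"
    using \<open>e > 0\<close> by (intro order_tendstoD(1)) auto
  then obtain F where F: "finite F" "sum f F > infsum f UNIV - e"
    unfolding eventually_finite_subsets_at_top by blast
  have "sum f G < e" if "finite G" "G \<inter> F = {}" for G
  proof -
    have "sum f G + sum f F = sum f (G \<union> F)"
      using that F(1) by (intro sum.union_disjoint[symmetric])
    also have "\<dots> \<le> infsum f UNIV"
      using that F(1) nonneg by (intro finite_sum_le_infsum f) auto
    finally show ?thesis using F(2) by simp
  qed
  with F(1) show ?thesis by blast
qed

lemma trig_sum_diff: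
  assumes "finite F" "G \<subseteq> F"
  shows "trig_sum a F \<theta> - trig_sum a G \<theta> = trig_sum a (F - G) \<theta>"
  using assms by (simp add: trig_sum_def sum_diff)

text \<open>Completeness is available for sequences, while the series is to converge along the net
  of all finite sets. A sequence of finite sets with small tails provides the limit, and the tail
  estimates, uniform over all larger finite sets, give convergence of the net.\<close>

lemma Riesz_Fischer:
  fixes a :: "int ^ 'n \<Rightarrow> complex"
  assumes a: "(\<lambda>k. (cmod (a k))\<^sup>2) summable_on UNIV"
  obtains u where "L2_has_sum torus (\<lambda>k \<theta>. torus_exp k \<theta> * a k) UNIV u"
proof -
  let ?n = "L2_norm (torus :: (real ^ 'n) measure)"
  have "\<exists>F. finite F \<and> (\<forall>G. finite G \<longrightarrow> G \<inter> F = {} \<longrightarrow> (\<Sum>k\<in>G. (cmod (a k))\<^sup>2) < (1 / Suc j)\<^sup>2)" for j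
    by (rule summable_on_small_tail[OF a]) auto
  then obtain F where F: "\<And>j. finite (F j)"
    "\<And>j G. finite G \<Longrightarrow> G \<inter> F j = {} \<Longrightarrow> (\<Sum>k\<in>G. (cmod (a k))\<^sup>2) < (1 / Suc j)\<^sup>2"
    by metis
  have tail: "?n (\<lambda>\<theta>. trig_sum a G \<theta> - trig_sum a (F j) \<theta>) < 1 / Suc j" if "finite G" "F j \<subseteq> G" for G j
  proof (rule power2_less_imp_less)
    have "(\<lambda>\<theta>. trig_sum a G \<theta> - trig_sum a (F j) \<theta>) = trig_sum a (G - F j)"
      using trig_sum_diff[OF that] by blast
    then have "(?n (\<lambda>\<theta>. trig_sum a G \<theta> - trig_sum a (F j) \<theta>))\<^sup>2 = (\<Sum>k\<in>G - F j. (cmod (a k))\<^sup>2)"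
      using that by (simp add: trig_sum_norm)
    also have "\<dots> < (1 / Suc j)\<^sup>2"
      using that by (intro F(2)) auto
    finally show "(?n (\<lambda>\<theta>. trig_sum a G \<theta> - trig_sum a (F j) \<theta>))\<^sup>2 < (1 / Suc j)\<^sup>2" .
  qed simp
  have tails: "?n (\<lambda>\<theta>. trig_sum a G \<theta> - trig_sum a H \<theta>) < 2 / Suc j"
    if "finite G" "F j \<subseteq> G" "finite H" "F j \<subseteq> H" for G H j
  proof -
    have "?n (\<lambda>\<theta>. trig_sum a G \<theta> - trig_sum a H \<theta>) \<le>
        ?n (\<lambda>\<theta>. trig_sum a G \<theta> - trig_sum a (F j) \<theta>) + ?n (\<lambda>\<theta>. trig_sum a (F j) \<theta> - trig_sum a H \<theta>)"
      by (intro L2_norm_diff_triangle trig_sum_L2)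
    also have "\<dots> < 1 / Suc j + 1 / Suc j"
      using tail[OF that(1,2)] tail[OF that(3,4)] L2_norm_minus_commute[of torus "trig_sum a (F j)" "trig_sum a H"]
      by simp
    finally show ?thesis by (simp add: add_divide_distrib[symmetric])
  qed
  \<comment> \<open>Unions make the sets increasing: \<open>G n\<close> contains \<open>F j\<close>
    for all \<open>j \<le> n\<close>, so the bound \<open>2 / Suc j\<close> holds at every index
    from \<open>j\<close> on.\<close>
  define G where "G n = (\<Union>j\<le>n. F j)" for n
  have G: "finite (G n)" "j \<le> n \<Longrightarrow> F j \<subseteq> G n" for n j
    using F(1) by (auto simp: G_def)
  have small: "\<exists>j. 2 / real (Suc j) < e" if e: "e > 0" for e
  proof -
    have "0 < e / 2" using e by simp
    then obtain j where "inverse (real (Suc j)) < e / 2"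
      using reals_Archimedean by blast
    then show ?thesis by (intro exI[of _ j]) (simp add: field_simps)
  qed
  obtain u where u: "u \<in> L2 torus" "(\<lambda>n. ?n (\<lambda>\<theta>. trig_sum a (G n) \<theta> - u \<theta>)) \<longlonglongrightarrow> 0"
  proof (rule torus.L2_complete)
    show "trig_sum a (G n) \<in> L2 torus" for n by (rule trig_sum_L2)
    fix e :: real assume "e > 0"
    then obtain j where j: "2 / real (Suc j) < e" using small by blast
    show "\<exists>N. \<forall>m\<ge>N. \<forall>n\<ge>N. ?n (\<lambda>\<theta>. trig_sum a (G m) \<theta> - trig_sum a (G n) \<theta>) < e"
      by (intro exI[of _ j] allI impI less_trans[OF tails j] G)
  qed
  have close: "?n (\<lambda>\<theta>. u \<theta> - trig_sum a H \<theta>) \<le> 2 / Suc j" if H: "finite H" "F j \<subseteq> H" for H j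
  proof (rule tendsto_lowerbound)
    show "((\<lambda>n. ?n (\<lambda>\<theta>. trig_sum a (G n) \<theta> - u \<theta>) + 2 / Suc j) \<longlongrightarrow> 2 / Suc j) sequentially"
      using tendsto_add[OF u(2) tendsto_const[of "2 / real (Suc j)"]] by simp
    show "\<forall>\<^sub>F n in sequentially. ?n (\<lambda>\<theta>. u \<theta> - trig_sum a H \<theta>) \<le> ?n (\<lambda>\<theta>. trig_sum a (G n) \<theta> - u \<theta>) + 2 / Suc j"
      using eventually_ge_at_top[of j]
    proof eventually_elim
      case (elim n)
      have "?n (\<lambda>\<theta>. u \<theta> - trig_sum a H \<theta>) \<le> ?n (\<lambda>\<theta>. u \<theta> - trig_sum a (G n) \<theta>) + ?n (\<lambda>\<theta>. trig_sum a (G n) \<theta> - trig_sum a H \<theta>)"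
        by (intro L2_norm_diff_triangle trig_sum_L2 u(1))
      then show ?case
        using tails[OF G(1) G(2)[OF elim] H] L2_norm_minus_commute[of torus u "trig_sum a (G n)"] by simp
    qed
  qed simp
  have "((\<lambda>H. ?n (\<lambda>\<theta>. u \<theta> - trig_sum a H \<theta>)) \<longlongrightarrow> 0) (finite_subsets_at_top UNIV)"
  proof (rule order_tendstoI)
    fix e :: real assume "0 < e"
    then obtain j where j: "2 / real (Suc j) < e" using small by blast
    show "\<forall>\<^sub>F H in finite_subsets_at_top UNIV. ?n (\<lambda>\<theta>. u \<theta> - trig_sum a H \<theta>) < e"
      unfolding eventually_finite_subsets_at_top
      using F(1) close j by (intro exI[of _ "F j"]) (auto intro: le_less_trans)
  next
    fix e :: real assume "e < 0"
    then show "\<forall>\<^sub>F H in finite_subsets_at_top UNIV. e < ?n (\<lambda>\<theta>. u \<theta> - trig_sum a H \<theta>)"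
      by (intro always_eventually allI less_le_trans[OF _ L2_norm_nonneg])
  qed
  then have "L2_has_sum torus (\<lambda>k \<theta>. torus_exp k \<theta> * a k) UNIV u"
    by (simp add: L2_has_sum_def u(1) torus_exp_scale_L2 flip: trig_sum_def)
  then show ?thesis by (rule that)
qed

lemma L2_has_sum_tendsto_inner:
  assumes "L2_has_sum M g A v" and w: "w \<in> L2 M"
  shows "((\<lambda>a. L2_inner M (g a) w) has_sum L2_inner M v w) A"
  unfolding has_sum_def
proof (rule Lim_transform_eventually)
  have g: "\<And>a. a \<in> A \<Longrightarrow> g a \<in> L2 M" and v: "v \<in> L2 M"
    and lim: "((\<lambda>F. L2_norm M (\<lambda>x. v x - (\<Sum>a\<in>F. g a x))) \<longlongrightarrow> 0) (finite_subsets_at_top A)"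
    using assms(1) by (auto simp: L2_has_sum_def)
  \<comment> \<open>Cutting down to \<open>A\<close> keeps every \<open>s F\<close> in L2, as the
    continuity lemma demands for all indices; along the filter nothing changes, since eventually
    \<open>F \<subseteq> A\<close>.\<close>
  define s where "s F x = (\<Sum>a\<in>F \<inter> A. g a x)" for F x
  have ev: "\<forall>\<^sub>F F in finite_subsets_at_top A. F \<inter> A = F"
    by (rule eventually_finite_subsets_at_top_weakI) auto
  have "((\<lambda>F. L2_norm M (\<lambda>x. s F x - v x)) \<longlongrightarrow> 0) (finite_subsets_at_top A)"
  proof (rule Lim_transform_eventually[OF lim], use ev in eventually_elim)
    case (elim F)
    then show ?case unfolding s_def by (subst L2_norm_minus_commute) simp
  qed
  then show "((\<lambda>F. L2_inner M (s F) w) \<longlongrightarrow> L2_inner M v w) (finite_subsets_at_top A)"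
    by (rule L2_inner_tendsto_left) (auto simp: s_def intro!: L2_sum g v w)
  show "\<forall>\<^sub>F F in finite_subsets_at_top A. L2_inner M (s F) w = (\<Sum>a\<in>F. L2_inner M (g a) w)"
    using ev
  proof eventually_elim
    case (elim F)
    then have "F \<subseteq> A" by blast
    then show ?case
      unfolding s_def elim by (intro L2_inner_sum_left w) (use g in blast)
  qed
qed

text \<open>Pair the series with \<open>torus_exp k\<close>: orthonormality leaves a single
  term.\<close>

lemma torus_Fourier_L2_has_sum:
  assumes "L2_has_sum torus (\<lambda>k \<theta>. torus_exp k \<theta> * a k) UNIV u"
  shows "torus_Fourier u k = a k"
proof -
  have "((\<lambda>l. L2_inner torus (\<lambda>\<theta>. torus_exp l \<theta> * a l) (torus_exp k)) has_sum torus_Fourier u k) UNIV"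
    unfolding torus_Fourier_eq_inner by (rule L2_has_sum_tendsto_inner[OF assms torus_exp_L2])
  moreover have "L2_inner torus (\<lambda>\<theta>. torus_exp l \<theta> * a l) (torus_exp k) = (if l = k then a k else 0)" for l
    using L2_inner_scale_left[of torus "a l" "torus_exp l" "torus_exp k"]
    by (simp add: torus_exp_orthonormal mult.commute)
  ultimately have "((\<lambda>l. if l = k then a k else 0) has_sum torus_Fourier u k) UNIV"
    by simp
  moreover have "((\<lambda>l. if l = k then a k else 0) has_sum a k) UNIV"
    using has_sum_finite_neutralI[of "{k}" UNIV "\<lambda>l. if l = k then a k else 0"] by simp
  ultimately show ?thesis by (rule has_sum_unique)
qed

text \<open>Riesz-Fischer gives some sum \<open>v\<close>, which has the same coefficients as
  \<open>u\<close>; by uniqueness the two agree almost everywhere. This is where completeness of the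
  exponentials enters.\<close>

lemma Fourier_series_L2_has_sum:
  assumes u: "u \<in> L2 torus"
  shows "L2_has_sum torus (\<lambda>k \<theta>. torus_exp k \<theta> * torus_Fourier u k) UNIV u"
proof -
  obtain v where v: "L2_has_sum torus (\<lambda>k \<theta>. torus_exp k \<theta> * torus_Fourier u k) UNIV v"
    using Riesz_Fischer[OF torus_Fourier_summable[OF u]] by blast
  then have v_L2: "v \<in> L2 torus" by (simp add: L2_has_sum_def)
  have diff: "(\<lambda>\<theta>. v \<theta> - u \<theta>) \<in> L2 torus" by (intro L2_diff v_L2 u)
  have "AE \<theta> in torus. v \<theta> - u \<theta> = 0"
  proof (rule torus_Fourier_unique)
    show "integrable torus (\<lambda>\<theta>. v \<theta> - u \<theta>)"
      using L2_integrable_mult[OF diff torus.L2_const[of 1]] by simp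
    show "torus_Fourier (\<lambda>\<theta>. v \<theta> - u \<theta>) k = 0" for k
      using torus_Fourier_L2_has_sum[OF v] by (simp add: torus_Fourier_diff v_L2 u)
  qed
  then have "L2_norm torus (\<lambda>\<theta>. v \<theta> - trig_sum (torus_Fourier u) F \<theta>) = L2_norm torus (\<lambda>\<theta>. u \<theta> - trig_sum (torus_Fourier u) F \<theta>)" for F
    by (intro L2_norm_cong_AE L2_diff v_L2 u trig_sum_L2) auto
  then show ?thesis
    using v u by (simp add: L2_has_sum_def flip: trig_sum_def)
qed

lemma Parseval:
  assumes u: "u \<in> L2 torus" and v: "v \<in> L2 torus"
  shows "((\<lambda>k. torus_Fourier u k * cnj (torus_Fourier v k)) has_sum L2_inner torus u v) UNIV"
proof -
  have "L2_inner torus (\<lambda>\<theta>. torus_exp k \<theta> * torus_Fourier u k) v = torus_Fourier u k * cnj (torus_Fourier v k)" for k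
    using trig_sum_inner[OF v, of "torus_Fourier u" "{k}"] by (simp add: trig_sum_def[abs_def])
  then show ?thesis
    using L2_has_sum_tendsto_inner[OF Fourier_series_L2_has_sum[OF u] v] by simp
qed

section \<open>The double adjoint\<close>

lemma L2_closureI_sequence:
  assumes "u \<in> L2 M" "v \<in> L2 M" and R: "\<And>n. (p n, q n) \<in> R"
    and "(\<lambda>n. L2_norm M (\<lambda>x. u x - p n x)) \<longlonglongrightarrow> 0" "(\<lambda>n. L2_norm M (\<lambda>x. v x - q n x)) \<longlonglongrightarrow> 0"
  shows "(u, v) \<in> L2_closure M R"
  unfolding L2_closure_def
proof (clarsimp simp: assms(1,2))
  fix e :: real assume "e > 0"
  then have "\<forall>\<^sub>F n in sequentially. L2_norm M (\<lambda>x. u x - p n x) < e \<and> L2_norm M (\<lambda>x. v x - q n x) < e"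
    using assms(4,5) by (intro eventually_conj order_tendstoD)
  then obtain n where "L2_norm M (\<lambda>x. u x - p n x) < e \<and> L2_norm M (\<lambda>x. v x - q n x) < e"
    using eventually_happens'[OF sequentially_bot] by blast
  then show "\<exists>x\<in>R. case x of (u', v') \<Rightarrow> L2_norm M (\<lambda>x. u x - u' x) < e \<and> L2_norm M (\<lambda>x. v x - v' x) < e"
    using R by blast
qed

text \<open>Every pair of \<open>R\<close> satisfies the equations that define the double adjoint,
  and by Cauchy-Schwarz these survive limits in both components.\<close>

lemma L2_closure_subset_adjoint_adjoint:
  assumes R: "R \<subseteq> L2 M \<times> L2 M"
  shows "L2_closure M R \<subseteq> L2_adjoint M (L2_adjoint M R)"
proof clarify
  fix u v assume uv: "(u, v) \<in> L2_closure M R"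
  then have u: "u \<in> L2 M" and v: "v \<in> L2 M" by (auto simp: L2_closure_def)
  have "L2_inner M y u = L2_inner M x v" if "(x, y) \<in> L2_adjoint M R" for x y
  proof -
    have x: "x \<in> L2 M" and y: "y \<in> L2 M" using that by (auto simp: L2_adjoint_def)
    define C where "C = L2_norm M x + L2_norm M y"
    have C: "C \<ge> 0" by (simp add: C_def)
    have bound: "cmod (L2_inner M v x - L2_inner M u y) \<le> e * C" if "e > 0" for e
    proof -
      obtain u' v' where R': "(u', v') \<in> R" and close: "L2_norm M (\<lambda>x. u x - u' x) < e" "L2_norm M (\<lambda>x. v x - v' x) < e"
        using uv \<open>e > 0\<close> unfolding L2_closure_def by blast
      have u': "u' \<in> L2 M" and v': "v' \<in> L2 M" using R' R by auto
      have "L2_inner M v' x = L2_inner M u' y"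
        using \<open>(x, y) \<in> L2_adjoint M R\<close> R' unfolding L2_adjoint_def by blast
      then have "L2_inner M v x - L2_inner M u y = L2_inner M (\<lambda>x. v x - v' x) x - L2_inner M (\<lambda>x. u x - u' x) y"
        by (simp add: L2_inner_diff_left u v u' v' x y)
      also have "cmod \<dots> \<le> cmod (L2_inner M (\<lambda>x. v x - v' x) x) + cmod (L2_inner M (\<lambda>x. u x - u' x) y)"
        by (rule norm_triangle_ineq4)
      also have "\<dots> \<le> L2_norm M (\<lambda>x. v x - v' x) * L2_norm M x + L2_norm M (\<lambda>x. u x - u' x) * L2_norm M y"
        by (intro add_mono L2_norm_Cauchy_Schwarz L2_diff u v u' v' x y)
      also have "\<dots> \<le> e * L2_norm M x + e * L2_norm M y"
        using close by (intro add_mono mult_right_mono) auto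
      finally show ?thesis by (simp add: C_def distrib_left)
    qed
    have "cmod (L2_inner M v x - L2_inner M u y) \<le> 0 + e" if "e > 0" for e
    proof -
      have "e / (C + 1) * C \<le> e" using C that by (simp add: field_simps)
      then show ?thesis using bound[of "e / (C + 1)"] C that by simp
    qed
    then have "cmod (L2_inner M v x - L2_inner M u y) \<le> 0"
      by (rule field_le_epsilon)
    then show ?thesis
      by (simp add: L2_inner_commute[of M y] L2_inner_commute[of M x])
  qed
  with u v show "(u, v) \<in> L2_adjoint M (L2_adjoint M R)"
    by (auto simp: L2_adjoint_def[of M "L2_adjoint M R"])
qed

text \<open>The parallelogram law for \<open>u - p\<close> and \<open>u - q\<close>, arranged to
  exhibit the midpoint of \<open>p\<close> and \<open>q\<close>. In the nearest point argument the
  midpoint stays in the graph, so its distance is bounded below and minimizing sequences are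
  Cauchy.\<close>

lemma L2_parallelogram:
  assumes "u \<in> L2 M" "p \<in> L2 M" "q \<in> L2 M"
  shows "(L2_norm M (\<lambda>x. p x - q x))\<^sup>2 = 2 * (L2_norm M (\<lambda>x. u x - p x))\<^sup>2
    + 2 * (L2_norm M (\<lambda>x. u x - q x))\<^sup>2 - 4 * (L2_norm M (\<lambda>x. u x - (1/2 * p x + 1/2 * q x)))\<^sup>2"
proof -
  define a where "a x = u x - p x" for x
  define b where "b x = u x - q x" for x
  have ab: "a \<in> L2 M" "b \<in> L2 M" unfolding a_def b_def by (intro L2_diff assms)+
  have "(\<lambda>x. u x - (1/2 * p x + 1/2 * q x)) = (\<lambda>x. 1/2 * (a x + b x))"
    by (simp add: a_def b_def fun_eq_iff field_simps)
  then have "4 * (L2_norm M (\<lambda>x. u x - (1/2 * p x + 1/2 * q x)))\<^sup>2 = (L2_norm M (\<lambda>x. a x + b x))\<^sup>2"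
    by (simp only: L2_norm_scale) (simp add: power_divide)
  moreover have "(\<lambda>x. p x - q x) = (\<lambda>x. b x - a x)"
    by (simp add: a_def b_def)
  then have "L2_norm M (\<lambda>x. p x - q x) = L2_norm M (\<lambda>x. a x - b x)"
    using L2_norm_minus_commute by metis
  ultimately show ?thesis
    using L2_norm_add_power2[OF ab] L2_norm_diff_power2[OF ab] by (simp flip: a_def b_def)
qed

lemma L2_norm_tendsto:
  assumes lim: "(\<lambda>n. L2_norm M (\<lambda>x. p n x - q x)) \<longlonglongrightarrow> 0"
    and "\<And>n. p n \<in> L2 M" "q \<in> L2 M" "u \<in> L2 M"
  shows "(\<lambda>n. L2_norm M (\<lambda>x. u x - p n x)) \<longlonglongrightarrow> L2_norm M (\<lambda>x. u x - q x)"
proof -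
  have "\<bar>L2_norm M (\<lambda>x. u x - p n x) - L2_norm M (\<lambda>x. u x - q x)\<bar> \<le> L2_norm M (\<lambda>x. p n x - q x)" for n
    using L2_norm_diff_triangle[of u M "p n" q] L2_norm_diff_triangle[of u M q "p n"]
      L2_norm_minus_commute[of M q "p n"] assms(2-4) by (simp add: abs_le_iff)
  then have "(\<lambda>n. L2_norm M (\<lambda>x. u x - p n x) - L2_norm M (\<lambda>x. u x - q x)) \<longlonglongrightarrow> 0"
    by (intro Lim_null_comparison[OF _ lim]) auto
  then show ?thesis by (simp add: LIM_zero_iff)
qed

text \<open>First-order optimality: for a small positive multiple \<open>c\<close> of
  \<open>z\<close> the linear term outweighs the quadratic one unless \<open>z = 0\<close>.\<close>

lemma complex_eq_0_if_quadratic_nonneg: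
  assumes K: "K \<ge> 0" and nonneg: "\<And>c. 0 \<le> (cmod c)\<^sup>2 * K - 2 * Re (cnj c * z)"
  shows "z = 0"
proof (rule ccontr)
  assume "z \<noteq> 0"
  \<comment> \<open>The minimizer would be \<open>z / K\<close>; the added 1 keeps the denominator
    positive when \<open>K = 0\<close>.\<close>
  define c where "c = z / of_real (K + 1)"
  have "Re (cnj c * z) = (cmod z)\<^sup>2 / (K + 1)"
    using cmod_power2[of z]
    by (simp add: c_def Re_divide_of_real Im_divide_of_real power2_eq_square add_divide_distrib del: of_real_add)
  moreover have "(cmod c)\<^sup>2 = (cmod z)\<^sup>2 / (K + 1)\<^sup>2"
    using K by (simp add: c_def norm_divide power_divide del: of_real_add)
  ultimately have "0 \<le> (cmod z)\<^sup>2 / (K + 1)\<^sup>2 * K - 2 * ((cmod z)\<^sup>2 / (K + 1))"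
    using nonneg[of c] by simp
  moreover have "(cmod z)\<^sup>2 / (K + 1)\<^sup>2 * K < 2 * ((cmod z)\<^sup>2 / (K + 1))"
  proof -
    have "(cmod z)\<^sup>2 / (K + 1)\<^sup>2 * K = (cmod z)\<^sup>2 / (K + 1) * (K / (K + 1))"
      by (simp add: power2_eq_square)
    also have "\<dots> \<le> (cmod z)\<^sup>2 / (K + 1) * 1"
      using K by (intro mult_left_mono) auto
    also have "\<dots> < 2 * ((cmod z)\<^sup>2 / (K + 1))"
    proof -
      have "(cmod z)\<^sup>2 / (K + 1) > 0"
        using K \<open>z \<noteq> 0\<close> by (intro divide_pos_pos) auto
      then show ?thesis by linarith
    qed
    finally show ?thesis .
  qed
  ultimately show False by linarith
qed

text \<open>The nearest point of the closed graph to \<open>(u, v)\<close> differs from it by a pair \<open>(x, y)\<close>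
  orthogonal to the graph, so \<open>(y, -x)\<close> lies in the graph of the adjoint; testing \<open>(u, v)\<close> against
  it shows \<open>(x, y) = 0\<close>.\<close>

lemma (in finite_measure) L2_adjoint_adjoint:
  assumes R: "R \<subseteq> L2 M \<times> L2 M" and ne: "R \<noteq> {}"
    and lin: "\<And>s t s' t' c c'. (s, t) \<in> R \<Longrightarrow> (s', t') \<in> R \<Longrightarrow>
      (\<lambda>x. c * s x + c' * s' x, \<lambda>x. c * t x + c' * t' x) \<in> R"
  shows "L2_adjoint M (L2_adjoint M R) = L2_closure M R"
proof (rule antisym[OF _ L2_closure_subset_adjoint_adjoint[OF R]], clarify)
  fix u v assume uv: "(u, v) \<in> L2_adjoint M (L2_adjoint M R)"
  then have u: "u \<in> L2 M" and v: "v \<in> L2 M"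
    by (auto simp: L2_adjoint_def[of M "L2_adjoint M R"])
  \<comment> \<open>Squared distance to \<open>(u, v)\<close> in the direct sum of two copies of L2;
    with the sum of squares the parallelogram law holds for pairs.\<close>
  define D where "D = (\<lambda>(p, q). (L2_norm M (\<lambda>x. u x - p x))\<^sup>2 + (L2_norm M (\<lambda>x. v x - q x))\<^sup>2)"
  define d where "d = (INF r\<in>R. D r)"
  have "bdd_below (D ` R)" by (rule bdd_belowI[of _ 0]) (auto simp: D_def)
  then have d: "d \<le> D r" if "r \<in> R" for r
    unfolding d_def using that by (rule cINF_lower)
  have "\<exists>r\<in>R. D r < d + 1 / Suc n" for n
  proof (rule ccontr)
    assume "\<not> ?thesis"
    then have "d + 1 / Suc n \<le> d"
      unfolding d_def using ne by (intro cINF_greatest) (auto simp: not_less)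
    then show False by simp
  qed
  then obtain r where r: "\<And>n. r n \<in> R" "\<And>n. D (r n) < d + 1 / Suc n" by metis
  define p q where "p n = fst (r n)" and "q n = snd (r n)" for n
  have pq: "(p n, q n) \<in> R" "D (p n, q n) < d + 1 / Suc n" for n
    using r[of n] by (simp_all add: p_def q_def)
  have p: "p n \<in> L2 M" and q: "q n \<in> L2 M" for n using pq(1) R by auto
  have cauchy: "(L2_norm M (\<lambda>x. p m x - p n x))\<^sup>2 + (L2_norm M (\<lambda>x. q m x - q n x))\<^sup>2 < 2 / Suc m + 2 / Suc n" for m n
  proof -
    \<comment> \<open>The midpoint is again in \<open>R\<close>, so its distance is at least
      \<open>d\<close>. The parallelogram law then bounds the left side by
      \<open>2 * D (p m, q m) + 2 * D (p n, q n) - 4 * d\<close>, in which \<open>d\<close>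
      cancels.\<close>
    have "d \<le> D (\<lambda>x. 1/2 * p m x + 1/2 * p n x, \<lambda>x. 1/2 * q m x + 1/2 * q n x)"
      by (intro d lin pq)
    then show ?thesis
      using pq(2)[of m] pq(2)[of n] L2_parallelogram[OF u p p, of m n] L2_parallelogram[OF v q q, of m n]
      by (simp add: D_def)
  qed
  have small: "\<exists>N. \<forall>m\<ge>N. \<forall>n\<ge>N. 2 / real (Suc m) + 2 / real (Suc n) < e\<^sup>2" if e: "e > 0" for e :: real
  proof -
    have "0 < e\<^sup>2 / 4" using e by simp
    then obtain N where N: "inverse (real (Suc N)) < e\<^sup>2 / 4"
      using reals_Archimedean by blast
    have "2 / real (Suc m) < e\<^sup>2 / 2" if "m \<ge> N" for m
    proof -
      have "2 / real (Suc m) \<le> 2 / real (Suc N)" using that by (intro divide_left_mono) auto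
      also have "\<dots> < e\<^sup>2 / 2" using N by (simp add: field_simps)
      finally show ?thesis .
    qed
    then show ?thesis by (metis add_strict_mono field_sum_of_halves)
  qed
  have "\<exists>N. \<forall>m\<ge>N. \<forall>n\<ge>N. L2_norm M (\<lambda>x. p m x - p n x) < e" if e: "e > 0" for e
  proof -
    obtain N where N: "\<forall>m\<ge>N. \<forall>n\<ge>N. 2 / real (Suc m) + 2 / real (Suc n) < e\<^sup>2" using small[OF e] by blast
    have "L2_norm M (\<lambda>x. p m x - p n x) < e" if "m \<ge> N" "n \<ge> N" for m n
    proof (rule power2_less_imp_less)
      have "2 / real (Suc m) + 2 / real (Suc n) < e\<^sup>2" using N that by blast
      then show "(L2_norm M (\<lambda>x. p m x - p n x))\<^sup>2 < e\<^sup>2"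
        using cauchy[of m n] zero_le_power2[of "L2_norm M (\<lambda>x. q m x - q n x)"] by linarith
    qed (use e in simp)
    then show ?thesis by blast
  qed
  then obtain p' where p': "p' \<in> L2 M" "(\<lambda>n. L2_norm M (\<lambda>x. p n x - p' x)) \<longlonglongrightarrow> 0"
    using L2_complete[of p] p by blast
  have "\<exists>N. \<forall>m\<ge>N. \<forall>n\<ge>N. L2_norm M (\<lambda>x. q m x - q n x) < e" if e: "e > 0" for e
  proof -
    obtain N where N: "\<forall>m\<ge>N. \<forall>n\<ge>N. 2 / real (Suc m) + 2 / real (Suc n) < e\<^sup>2" using small[OF e] by blast
    have "L2_norm M (\<lambda>x. q m x - q n x) < e" if "m \<ge> N" "n \<ge> N" for m n
    proof (rule power2_less_imp_less)
      have "2 / real (Suc m) + 2 / real (Suc n) < e\<^sup>2" using N that by blast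
      then show "(L2_norm M (\<lambda>x. q m x - q n x))\<^sup>2 < e\<^sup>2"
        using cauchy[of m n] zero_le_power2[of "L2_norm M (\<lambda>x. p m x - p n x)"] by linarith
    qed (use e in simp)
    then show ?thesis by blast
  qed
  then obtain q' where q': "q' \<in> L2 M" "(\<lambda>n. L2_norm M (\<lambda>x. q n x - q' x)) \<longlonglongrightarrow> 0"
    using L2_complete[of q] q by blast
  define X where "X x = u x - p' x" for x
  define Y where "Y x = v x - q' x" for x
  have X: "X \<in> L2 M" and Y: "Y \<in> L2 M"
    unfolding X_def Y_def by (intro L2_diff u v p' q')+
  have "(\<lambda>n. D (p n, q n)) \<longlonglongrightarrow> (L2_norm M X)\<^sup>2 + (L2_norm M Y)\<^sup>2"
    unfolding D_def X_def Y_def prod.case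
    by (intro tendsto_intros L2_norm_tendsto p p' q q' u v)
  moreover have "(\<lambda>n. d + 1 / real (Suc n)) \<longlonglongrightarrow> d"
    using tendsto_add[OF tendsto_const[of d] LIMSEQ_Suc[OF lim_inverse_n']] by simp
  ultimately have min: "(L2_norm M X)\<^sup>2 + (L2_norm M Y)\<^sup>2 \<le> d"
    using pq(2) by (intro LIMSEQ_le) (auto intro: less_imp_le)
  have orth: "L2_inner M X s + L2_inner M Y t = 0" if st: "(s, t) \<in> R" for s t
  proof (rule complex_eq_0_if_quadratic_nonneg[where K = "(L2_norm M s)\<^sup>2 + (L2_norm M t)\<^sup>2"])
    have s: "s \<in> L2 M" and t: "t \<in> L2 M" using st R by auto
    fix c
    \<comment> \<open>The limit \<open>(p', q')\<close> need not lie in \<open>R\<close>, so the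
      variation is made at the approximants, where linearity applies, and only then passed to the
      limit.\<close>
    have "d \<le> D (\<lambda>x. 1 * p n x + c * s x, \<lambda>x. 1 * q n x + c * t x)" for n
      by (intro d lin pq st)
    then have "d \<le> (L2_norm M (\<lambda>x. (u x - c * s x) - p n x))\<^sup>2 + (L2_norm M (\<lambda>x. (v x - c * t x) - q n x))\<^sup>2" for n
      by (simp add: D_def algebra_simps)
    moreover have "(\<lambda>n. (L2_norm M (\<lambda>x. (u x - c * s x) - p n x))\<^sup>2 + (L2_norm M (\<lambda>x. (v x - c * t x) - q n x))\<^sup>2)
        \<longlonglongrightarrow> (L2_norm M (\<lambda>x. (u x - c * s x) - p' x))\<^sup>2 + (L2_norm M (\<lambda>x. (v x - c * t x) - q' x))\<^sup>2"
      by (intro tendsto_intros L2_norm_tendsto L2_diff L2_scale p p' q q' u v s t)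
    ultimately have "d \<le> (L2_norm M (\<lambda>x. (u x - c * s x) - p' x))\<^sup>2 + (L2_norm M (\<lambda>x. (v x - c * t x) - q' x))\<^sup>2"
      by (intro LIMSEQ_le_const) auto
    also have "\<dots> = (L2_norm M (\<lambda>x. X x - c * s x))\<^sup>2 + (L2_norm M (\<lambda>x. Y x - c * t x))\<^sup>2"
      by (simp add: X_def Y_def algebra_simps)
    finally show "0 \<le> (cmod c)\<^sup>2 * ((L2_norm M s)\<^sup>2 + (L2_norm M t)\<^sup>2) - 2 * Re (cnj c * (L2_inner M X s + L2_inner M Y t))"
      using min
      unfolding L2_norm_diff_power2[OF X L2_scale[OF s]] L2_norm_diff_power2[OF Y L2_scale[OF t]]
        L2_norm_scale L2_inner_scale_right power_mult_distrib distrib_left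
      by simp
  qed simp
  have "(Y, \<lambda>x. -1 * X x) \<in> L2_adjoint M R"
    unfolding L2_adjoint_def
  proof (clarsimp simp only: mem_Collect_eq prod.case Y L2_scale[OF X], intro conjI ballI TrueI, clarify)
    fix s t assume "(s, t) \<in> R"
    then have "L2_inner M Y t = - L2_inner M X s"
      using orth by (simp add: add_eq_0_iff)
    then show "L2_inner M t Y = L2_inner M s (\<lambda>x. -1 * X x)"
      by (simp only: L2_inner_scale_right L2_inner_commute[of M t] L2_inner_commute[of M s X]) simp
  qed
  moreover have lim: "(\<lambda>n. L2_norm M (\<lambda>x. p' x - p n x)) \<longlonglongrightarrow> 0" "(\<lambda>n. L2_norm M (\<lambda>x. q' x - q n x)) \<longlonglongrightarrow> 0"
    using p'(2) q'(2) by (simp_all add: L2_norm_minus_commute[of M p'] L2_norm_minus_commute[of M q'])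
  \<comment> \<open>The nearest point is a limit of pairs in \<open>R\<close> and so lies in the
    double adjoint too. Testing it and \<open>(u, v)\<close> against \<open>(Y, -X)\<close> and
    subtracting equates minus the squared norm of \<open>X\<close> with the squared norm of
    \<open>Y\<close>.\<close>
  have "(p', q') \<in> L2_adjoint M (L2_adjoint M R)"
    using L2_closureI_sequence[OF p'(1) q'(1) pq(1) lim] L2_closure_subset_adjoint_adjoint[OF R] by blast
  ultimately have "L2_inner M (\<lambda>x. -1 * X x) u = L2_inner M Y v" "L2_inner M (\<lambda>x. -1 * X x) p' = L2_inner M Y q'"
    using uv by (auto simp only: L2_adjoint_def[of M "L2_adjoint M R"])
  then have "L2_inner M (\<lambda>x. -1 * X x) X = L2_inner M Y Y"
    using L2_inner_diff_right[OF L2_scale[OF X, of "-1"] u p'(1)] L2_inner_diff_right[OF Y v q'(1)]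
    by (simp add: X_def[abs_def] Y_def[abs_def])
  then have "complex_of_real (- ((L2_norm M X)\<^sup>2)) = complex_of_real ((L2_norm M Y)\<^sup>2)"
    by (simp add: L2_inner_scale_left[of M "-1", simplified] L2_inner_self)
  then have "- ((L2_norm M X)\<^sup>2) = (L2_norm M Y)\<^sup>2" by (simp only: of_real_eq_iff)
  then have "(L2_norm M X)\<^sup>2 = 0" "(L2_norm M Y)\<^sup>2 = 0"
    using zero_le_power2[of "L2_norm M X"] zero_le_power2[of "L2_norm M Y"] by linarith+
  then have zero: "L2_norm M X = 0" "L2_norm M Y = 0"
    by simp_all
  show "(u, v) \<in> L2_closure M R"
  proof (rule L2_closureI_sequence[OF u v pq(1)])
    show "(\<lambda>n. L2_norm M (\<lambda>x. u x - p n x)) \<longlonglongrightarrow> 0"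
      using L2_norm_tendsto[OF p'(2) p p'(1) u] zero by (simp add: X_def[abs_def])
    show "(\<lambda>n. L2_norm M (\<lambda>x. v x - q n x)) \<longlonglongrightarrow> 0"
      using L2_norm_tendsto[OF q'(2) q q'(1) v] zero by (simp add: Y_def[abs_def])
  qed
qed

section \<open>The Fourier transform between the lattice and the torus\<close>

text \<open>The sign is chosen so that the exponential of the semi-classical transform at this point
  is \<open>torus_exp k\<close>.\<close>

definition lattice_point :: "real \<Rightarrow> int ^ 'n \<Rightarrow> real ^ 'n" where
  "lattice_point h k = - (h *\<^sub>R zvec k)"

lemma bij_betw_lattice_point:
  assumes "h > 0"
  shows "bij_betw (lattice_point h) UNIV (hlattice h :: (real ^ 'n) set)"
  unfolding bij_betw_def
proof
  show "inj (lattice_point h :: int ^ 'n \<Rightarrow> _)"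
    using assms by (auto simp: inj_on_def lattice_point_def)
  have "lattice_point h k = h *\<^sub>R zvec (- k)" for k :: "int ^ 'n"
    by (simp add: lattice_point_def zvec_minus)
  then show "range (lattice_point h) = (hlattice h :: (real ^ 'n) set)"
    unfolding hlattice_def by (metis (no_types, lifting) image_cong image_image surj_uminus)
qed

lemma cis_lattice_point:
  assumes "h > 0"
  shows "cis (- 2 * pi / h * (lattice_point h k \<bullet> \<theta>)) = torus_exp k \<theta>"
    and "cis (2 * pi / h * (lattice_point h k \<bullet> \<theta>)) = cnj (torus_exp k \<theta>)"
  using assms by (simp_all add: lattice_point_def torus_exp_def inner_commute cis_cnj mult.assoc)

lemma ball_hlattice:
  assumes "h > 0"
  shows "(\<forall>q\<in>hlattice h. P q) \<longleftrightarrow> (\<forall>k. P (lattice_point h k))"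
  using bij_betw_imp_surj_on[OF bij_betw_lattice_point[OF assms]] by (metis UNIV_I imageE imageI)

lemma L2_lattice_iff:
  assumes "h > 0"
  shows "f \<in> L2 (lattice_measure h) \<longleftrightarrow> (\<lambda>k. (cmod (f (lattice_point h k)))\<^sup>2) summable_on UNIV"
proof -
  have "f \<in> L2 (lattice_measure h) \<longleftrightarrow> Infinite_Set_Sum.abs_summable_on (\<lambda>q. (cmod (f q))\<^sup>2) (hlattice h)"
    by (simp add: L2_def Infinite_Set_Sum.abs_summable_on_def)
  also have "\<dots> \<longleftrightarrow> (\<lambda>q. (cmod (f q))\<^sup>2) summable_on hlattice h"
    by (subst abs_summable_equivalent[symmetric]) simp
  also have "\<dots> \<longleftrightarrow> (\<lambda>k. (cmod (f (lattice_point h k)))\<^sup>2) summable_on UNIV"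
    by (rule summable_on_reindex_bij_betw[OF bij_betw_lattice_point[OF assms], symmetric])
  finally show ?thesis .
qed

lemma L2_inner_lattice:
  assumes "h > 0" "f \<in> L2 (lattice_measure h)" "g \<in> L2 (lattice_measure h)"
  shows "L2_inner (lattice_measure h) f g = (\<Sum>\<^sub>\<infinity>k. f (lattice_point h k) * cnj (g (lattice_point h k)))"
proof -
  have "Infinite_Set_Sum.abs_summable_on (\<lambda>q. f q * cnj (g q)) (hlattice h)"
    using L2_integrable_mult_cnj[OF assms(2,3)] by (simp add: Infinite_Set_Sum.abs_summable_on_def)
  then have "L2_inner (lattice_measure h) f g = (\<Sum>\<^sub>\<infinity>q\<in>hlattice h. f q * cnj (g q))"
    by (simp add: L2_inner_def infsetsum_def[symmetric] infsetsum_infsum)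
  also have "\<dots> = (\<Sum>\<^sub>\<infinity>k. f (lattice_point h k) * cnj (g (lattice_point h k)))"
    by (rule infsum_reindex_bij_betw[OF bij_betw_lattice_point[OF assms(1)], symmetric])
  finally show ?thesis .
qed

lemma L2_has_sum_reindex:
  assumes "bij_betw b A B"
  shows "L2_has_sum M g B v \<longleftrightarrow> L2_has_sum M (\<lambda>a. g (b a)) A v"
proof -
  have inj: "inj_on b A" and B: "B = b ` A"
    using assms by (auto simp: bij_betw_def)
  have "((\<lambda>F. L2_norm M (\<lambda>x. v x - (\<Sum>a\<in>F. g a x))) \<longlongrightarrow> 0) (finite_subsets_at_top B) \<longleftrightarrow>
      ((\<lambda>F. L2_norm M (\<lambda>x. v x - (\<Sum>a\<in>b ` F. g a x))) \<longlongrightarrow> 0) (finite_subsets_at_top A)"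
    unfolding B filtermap_image_finite_subsets_at_top[OF inj, symmetric]
    by (simp add: filterlim_filtermap)
  also have "\<dots> \<longleftrightarrow> ((\<lambda>F. L2_norm M (\<lambda>x. v x - (\<Sum>a\<in>F. g (b a) x))) \<longlongrightarrow> 0) (finite_subsets_at_top A)"
  proof (rule tendsto_cong, rule eventually_finite_subsets_at_top_weakI)
    fix F assume "F \<subseteq> A"
    then have "inj_on b F" using inj inj_on_subset by blast
    then show "L2_norm M (\<lambda>x. v x - (\<Sum>a\<in>b ` F. g a x)) = L2_norm M (\<lambda>x. v x - (\<Sum>a\<in>F. g (b a) x))"
      by (simp add: sum.reindex)
  qed
  finally show ?thesis
    by (auto simp: L2_has_sum_def B)
qed

lemma hFourier_inv_iff:
  assumes "h > 0"
  shows "(u, f) \<in> hFourier_inv h \<longleftrightarrow> u \<in> L2 torus \<and> (\<forall>k. f (lattice_point h k) = torus_Fourier u k)"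
proof -
  have "(LINT \<theta>|torus. cis (2 * pi / h * (lattice_point h k \<bullet> \<theta>)) * u \<theta>) = torus_Fourier u k" for k
    unfolding cis_lattice_point(2)[OF assms] torus_Fourier_eq_inner L2_inner_def by (simp add: mult.commute)
  then show ?thesis
    unfolding hFourier_inv_def ball_hlattice[OF assms]
    using torus_Fourier_summable[of u] by (auto simp: L2_lattice_iff[OF assms])
qed

text \<open>The condition is that of \<open>hFourier_inv_iff\<close>, so the two graphs are converse
  to each other. Forwards, a convergent exponential series has its own terms as coefficients;
  backwards, Bessel gives square-summability and \<open>u\<close> is the sum of its Fourier
  series.\<close>

lemma hFourier_iff:
  assumes "h > 0"
  shows "(f, u) \<in> hFourier h \<longleftrightarrow> u \<in> L2 torus \<and> (\<forall>k. f (lattice_point h k) = torus_Fourier u k)"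
proof -
  have "(f, u) \<in> hFourier h \<longleftrightarrow> f \<in> L2 (lattice_measure h) \<and>
      L2_has_sum torus (\<lambda>k \<theta>. torus_exp k \<theta> * f (lattice_point h k)) UNIV u"
    unfolding hFourier_def
    by (simp add: L2_has_sum_reindex[OF bij_betw_lattice_point[OF assms]] cis_lattice_point(1)[OF assms, simplified])
  also have "\<dots> \<longleftrightarrow> u \<in> L2 torus \<and> (\<forall>k. f (lattice_point h k) = torus_Fourier u k)"
    using torus_Fourier_L2_has_sum[of "\<lambda>k. f (lattice_point h k)" u] Fourier_series_L2_has_sum[of u]
      torus_Fourier_summable[of u]
    by (auto simp: L2_lattice_iff[OF assms] L2_has_sum_def)
  finally show ?thesis .
qed

lemma hFourier_L2:
  assumes "h > 0" "(f, u) \<in> hFourier h"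
  shows "f \<in> L2 (lattice_measure h)" "u \<in> L2 torus"
  using assms(2) hFourier_iff[OF assms(1)] by (auto simp: hFourier_def)

lemma hFourier_ex_image:
  assumes "h > 0" "f \<in> L2 (lattice_measure h)"
  obtains u where "(f, u) \<in> hFourier h"
proof -
  obtain u where u: "L2_has_sum torus (\<lambda>k \<theta>. torus_exp k \<theta> * f (lattice_point h k)) UNIV u"
    using Riesz_Fischer[of "\<lambda>k. f (lattice_point h k)"] assms(2) L2_lattice_iff[OF assms(1)] by blast
  have "(f, u) \<in> hFourier h"
    using u torus_Fourier_L2_has_sum[OF u] by (simp add: hFourier_iff[OF assms(1)] L2_has_sum_def)
  then show ?thesis by (rule that)
qed

lemma hFourier_ex_preimage:
  fixes u :: "real ^ 'n \<Rightarrow> complex"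
  assumes "h > 0" "u \<in> L2 torus"
  obtains f where "(f, u) \<in> hFourier h"
proof -
  have inj: "inj (lattice_point h :: int ^ 'n \<Rightarrow> _)"
    using bij_betw_lattice_point[OF assms(1)] by (rule bij_betw_imp_inj_on)
  \<comment> \<open>Off the lattice \<open>inv\<close> returns arbitrary indices; the graph ignores
    those values.\<close>
  then have "(\<lambda>q. torus_Fourier u (inv (lattice_point h) q), u) \<in> hFourier h"
    using assms by (simp add: hFourier_iff inv_f_f)
  then show ?thesis by (rule that)
qed

text \<open>Unitarity: by Parseval both inner products are the same sum over Fourier
  coefficients.\<close>

lemma hFourier_inner:
  assumes h: "h > 0" and fu: "(f, u) \<in> hFourier h" and gv: "(g, v) \<in> hFourier h"
  shows "L2_inner (lattice_measure h) f g = L2_inner torus u v"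
proof -
  have "L2_inner (lattice_measure h) f g = (\<Sum>\<^sub>\<infinity>k. torus_Fourier u k * cnj (torus_Fourier v k))"
    using fu gv by (simp add: L2_inner_lattice[OF h hFourier_L2(1)[OF h fu] hFourier_L2(1)[OF h gv]] hFourier_iff[OF h])
  also have "\<dots> = L2_inner torus u v"
    by (intro infsumI Parseval hFourier_L2(2)[OF h fu] hFourier_L2(2)[OF h gv])
  finally show ?thesis .
qed

section \<open>Synthesis operators with square-integrable columns, their adjoints and
  closures\<close>

definition synthesis :: "(int ^ 'n \<Rightarrow> real ^ 'n \<Rightarrow> complex) \<Rightarrow> (real ^ 'n) L2_op" where
  "synthesis c = {(u, v). u \<in> L2 torus \<and> L2_has_sum torus (\<lambda>k \<theta>. c k \<theta> * torus_Fourier u k) UNIV v}"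

lemma synthesis_L2: "synthesis c \<subseteq> L2 torus \<times> L2 torus"
  by (auto simp: synthesis_def L2_has_sum_def)

lemma L2_has_sum_finite_support:
  assumes "finite F" "\<And>a. a \<notin> F \<Longrightarrow> g a = (\<lambda>x. 0)" "\<And>a. g a \<in> L2 M"
  shows "L2_has_sum M g UNIV (\<lambda>x. \<Sum>a\<in>F. g a x)"
  unfolding L2_has_sum_def
proof (intro conjI ballI L2_sum assms(3))
  have "\<forall>\<^sub>F G in finite_subsets_at_top UNIV. L2_norm M (\<lambda>x. (\<Sum>a\<in>F. g a x) - (\<Sum>a\<in>G. g a x)) = 0"
    unfolding eventually_finite_subsets_at_top
  proof (intro exI[of _ F] conjI allI impI)
    fix G assume G: "finite G \<and> F \<subseteq> G \<and> G \<subseteq> UNIV"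
    have "(\<Sum>a\<in>F. g a x) = (\<Sum>a\<in>G. g a x)" for x
      using G assms(2) by (intro sum.mono_neutral_left) auto
    then show "L2_norm M (\<lambda>x. (\<Sum>a\<in>F. g a x) - (\<Sum>a\<in>G. g a x)) = 0"
      by (simp add: L2_norm_def)
  qed (use assms(1) in auto)
  then show "((\<lambda>G. L2_norm M (\<lambda>x. (\<Sum>a\<in>F. g a x) - (\<Sum>a\<in>G. g a x))) \<longlongrightarrow> 0) (finite_subsets_at_top UNIV)"
    by (rule tendsto_eventually)
qed

text \<open>Only finitely many coefficients are nonzero, so convergence is trivial. These pairs
  serve to test the adjoint and, later, to apply an operator bound to partial sums.\<close>

lemma synthesis_trig_sum:
  assumes c: "\<And>k. c k \<in> L2 torus" and F: "finite F"
  shows "(trig_sum a F, \<lambda>\<theta>. \<Sum>k\<in>F. c k \<theta> * a k) \<in> synthesis c"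
proof -
  have c': "(\<lambda>\<theta>. c k \<theta> * b) \<in> L2 torus" for k b
    using L2_scale[OF c, of b k] by (simp add: mult.commute)
  have "L2_has_sum torus (\<lambda>k \<theta>. c k \<theta> * torus_Fourier (trig_sum a F) k) UNIV
      (\<lambda>\<theta>. \<Sum>k\<in>F. c k \<theta> * torus_Fourier (trig_sum a F) k)"
    by (rule L2_has_sum_finite_support[OF F]) (simp_all add: torus_Fourier_trig_sum[OF F] c')
  then show ?thesis
    by (simp add: synthesis_def trig_sum_L2 torus_Fourier_trig_sum[OF F] cong: sum.cong)
qed

text \<open>Testing on \<open>torus_exp k\<close>, which is mapped to \<open>c k\<close>, forces the
  coefficient condition. Conversely the defining series may be paired with \<open>v\<close> term by
  term, and Parseval sums the result to the inner product with \<open>w\<close>. The adjoint is thus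
  the analysis operator of frame theory, which sends \<open>v\<close> to the function with
  coefficients (v, c_k), on its maximal domain.\<close>

lemma synthesis_adjoint_iff:
  assumes c: "\<And>k. c k \<in> L2 torus"
  shows "(v, w) \<in> L2_adjoint torus (synthesis c) \<longleftrightarrow>
    v \<in> L2 torus \<and> w \<in> L2 torus \<and> (\<forall>k. L2_inner torus v (c k) = torus_Fourier w k)"
proof (intro iffI conjI allI)
  assume vw: "(v, w) \<in> L2_adjoint torus (synthesis c)"
  then show "v \<in> L2 torus" "w \<in> L2 torus" by (auto simp: L2_adjoint_def)
  fix k
  have "(torus_exp k, c k) \<in> synthesis c"
    using synthesis_trig_sum[OF c, of "{k}" "\<lambda>_. 1"] by (simp add: trig_sum_def[abs_def])
  then have "L2_inner torus (c k) v = L2_inner torus (torus_exp k) w"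
    using vw by (auto simp: L2_adjoint_def)
  then show "L2_inner torus v (c k) = torus_Fourier w k"
    unfolding torus_Fourier_eq_inner using L2_inner_commute by metis
next
  assume vw: "v \<in> L2 torus \<and> w \<in> L2 torus \<and> (\<forall>k. L2_inner torus v (c k) = torus_Fourier w k)"
  have "L2_inner torus u' v = L2_inner torus u w" if uu': "(u, u') \<in> synthesis c" for u u'
  proof -
    have "L2_inner torus (\<lambda>\<theta>. c k \<theta> * torus_Fourier u k) v = torus_Fourier u k * cnj (torus_Fourier w k)" for k
      using vw L2_inner_scale_left[of torus "torus_Fourier u k" "c k" v] L2_inner_commute[of torus "c k" v]
      by (simp add: mult.commute)
    moreover have "((\<lambda>k. L2_inner torus (\<lambda>\<theta>. c k \<theta> * torus_Fourier u k) v) has_sum L2_inner torus u' v) UNIV"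
      using uu' vw by (intro L2_has_sum_tendsto_inner) (auto simp: synthesis_def)
    ultimately have "((\<lambda>k. torus_Fourier u k * cnj (torus_Fourier w k)) has_sum L2_inner torus u' v) UNIV"
      by simp
    moreover have "((\<lambda>k. torus_Fourier u k * cnj (torus_Fourier w k)) has_sum L2_inner torus u w) UNIV"
      using uu' vw by (intro Parseval) (auto simp: synthesis_def)
    ultimately show ?thesis by (rule has_sum_unique)
  qed
  then show "(v, w) \<in> L2_adjoint torus (synthesis c)"
    using vw by (auto simp: L2_adjoint_def)
qed

lemma L2_has_sum_linear:
  assumes g: "L2_has_sum M g A v" and g': "L2_has_sum M g' A v'"
  shows "L2_has_sum M (\<lambda>a x. b * g a x + b' * g' a x) A (\<lambda>x. b * v x + b' * v' x)"
proof -
  have L2: "\<And>a. a \<in> A \<Longrightarrow> g a \<in> L2 M" "\<And>a. a \<in> A \<Longrightarrow> g' a \<in> L2 M" "v \<in> L2 M" "v' \<in> L2 M"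
    using g g' by (auto simp: L2_has_sum_def)
  let ?D = "\<lambda>F. L2_norm M (\<lambda>x. (b * v x + b' * v' x) - (\<Sum>a\<in>F. b * g a x + b' * g' a x))"
  let ?d = "\<lambda>F. L2_norm M (\<lambda>x. v x - (\<Sum>a\<in>F. g a x))"
  let ?d' = "\<lambda>F. L2_norm M (\<lambda>x. v' x - (\<Sum>a\<in>F. g' a x))"
  have "(?D \<longlongrightarrow> 0) (finite_subsets_at_top A)"
  proof (rule Lim_null_comparison)
    show "\<forall>\<^sub>F F in finite_subsets_at_top A. norm (?D F) \<le> cmod b * ?d F + cmod b' * ?d' F"
    proof (rule eventually_finite_subsets_at_top_weakI)
      fix F assume "F \<subseteq> A"
      then have d: "(\<lambda>x. v x - (\<Sum>a\<in>F. g a x)) \<in> L2 M" "(\<lambda>x. v' x - (\<Sum>a\<in>F. g' a x)) \<in> L2 M"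
        by (auto intro!: L2_diff L2_sum L2)
      have "(\<lambda>x. (b * v x + b' * v' x) - (\<Sum>a\<in>F. b * g a x + b' * g' a x)) =
          (\<lambda>x. b * (v x - (\<Sum>a\<in>F. g a x)) + b' * (v' x - (\<Sum>a\<in>F. g' a x)))"
        by (simp add: sum.distrib sum_distrib_left algebra_simps)
      then show "norm (?D F) \<le> cmod b * ?d F + cmod b' * ?d' F"
        using L2_norm_triangle[OF L2_scale[OF d(1), of b] L2_scale[OF d(2), of b']]
        by (simp only: L2_norm_scale real_norm_def abs_of_nonneg L2_norm_nonneg)
    qed
    have "((\<lambda>F. cmod b * ?d F + cmod b' * ?d' F) \<longlongrightarrow> cmod b * 0 + cmod b' * 0) (finite_subsets_at_top A)"
      using g g' by (intro tendsto_intros) (auto simp: L2_has_sum_def)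
    then show "((\<lambda>F. cmod b * ?d F + cmod b' * ?d' F) \<longlongrightarrow> 0) (finite_subsets_at_top A)"
      by simp
  qed
  then show ?thesis
    unfolding L2_has_sum_def by (auto intro!: L2_add L2_scale L2)
qed

lemma torus_Fourier_linear:
  "u \<in> L2 torus \<Longrightarrow> v \<in> L2 torus \<Longrightarrow>
    torus_Fourier (\<lambda>\<theta>. b * u \<theta> + b' * v \<theta>) k = b * torus_Fourier u k + b' * torus_Fourier v k"
  by (simp add: torus_Fourier_eq_inner L2_inner_add_left L2_scale torus_exp_L2 L2_inner_scale_left)

lemma synthesis_linear:
  assumes "(s, t) \<in> synthesis c" "(s', t') \<in> synthesis c"
  shows "(\<lambda>x. b * s x + b' * s' x, \<lambda>x. b * t x + b' * t' x) \<in> synthesis c"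
proof -
  have L2: "s \<in> L2 torus" "s' \<in> L2 torus" using assms by (auto simp: synthesis_def)
  have "L2_has_sum torus (\<lambda>k \<theta>. b * (c k \<theta> * torus_Fourier s k) + b' * (c k \<theta> * torus_Fourier s' k)) UNIV
      (\<lambda>x. b * t x + b' * t' x)"
    using assms by (intro L2_has_sum_linear) (auto simp: synthesis_def)
  then have "L2_has_sum torus (\<lambda>k \<theta>. c k \<theta> * torus_Fourier (\<lambda>x. b * s x + b' * s' x) k) UNIV (\<lambda>x. b * t x + b' * t' x)"
    by (simp add: torus_Fourier_linear L2 algebra_simps)
  then show ?thesis by (simp add: synthesis_def L2_add L2_scale L2)
qed

lemma synthesis_closure:
  assumes "\<And>k. c k \<in> L2 torus"
  shows "L2_adjoint torus (L2_adjoint torus (synthesis c)) = L2_closure torus (synthesis c)"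
proof (rule torus.L2_adjoint_adjoint)
  show "synthesis c \<noteq> {}" using synthesis_trig_sum[of c "{}", OF assms] by blast
qed (fact synthesis_L2, fact synthesis_linear)

text \<open>The series of \<open>u\<close> itself has to converge to \<open>v\<close>, so an
  approximating pair \<open>(u', v')\<close> is compared partial sum by partial sum. The partial sum
  for the coefficients of \<open>u' - u\<close> is the operator applied to a trigonometric
  polynomial, hence at most \<open>C\<close> times the norm of \<open>u' - u\<close>, uniformly in
  the finite set.\<close>

lemma synthesis_closed_if_bounded:
  assumes c: "\<And>k. c k \<in> L2 torus" and bounded: "L2_bounded torus (synthesis c)"
  shows "L2_closure torus (synthesis c) = synthesis c"
proof (intro antisym subrelI)
  let ?n = "L2_norm torus"
  obtain C' where C': "\<And>u v. (u, v) \<in> synthesis c \<Longrightarrow> ?n v \<le> C' * ?n u"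
    using bounded unfolding L2_bounded_def by blast
  define C where "C = max C' 0"
  have C: "C \<ge> 0" "\<And>u v. (u, v) \<in> synthesis c \<Longrightarrow> ?n v \<le> C * ?n u"
  proof -
    fix u v assume "(u, v) \<in> synthesis c"
    then have "?n v \<le> C' * ?n u" by (rule C')
    also have "\<dots> \<le> C * ?n u" by (intro mult_right_mono) (auto simp: C_def)
    finally show "?n v \<le> C * ?n u" .
  qed (simp add: C_def)
  fix u v assume uv: "(u, v) \<in> L2_closure torus (synthesis c)"
  then have u: "u \<in> L2 torus" and v: "v \<in> L2 torus" by (auto simp: L2_closure_def)
  define S where "S a F \<theta> = (\<Sum>k\<in>F. c k \<theta> * a k)" for a F \<theta>
  have c': "(\<lambda>\<theta>. c k \<theta> * b) \<in> L2 torus" for k b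
    using L2_scale[OF c, of b k] by (simp add: mult.commute)
  have S: "S a F \<in> L2 torus" for a F
    unfolding S_def by (intro L2_sum c')
  have "((\<lambda>F. ?n (\<lambda>\<theta>. v \<theta> - S (torus_Fourier u) F \<theta>)) \<longlongrightarrow> 0) (finite_subsets_at_top UNIV)"
  proof (rule order_tendstoI)
    fix e :: real assume "0 < e"
    \<comment> \<open>Three errors share \<open>e\<close>: the distance of \<open>v\<close> to
      \<open>v'\<close>, the remainder of the series of \<open>u'\<close>, and \<open>C\<close>
      times the distance of \<open>u\<close> to \<open>u'\<close>.\<close>
    define d where "d = e / (C + 2)"
    have d: "d > 0" using C(1) \<open>0 < e\<close> by (simp add: d_def)
    have "(C + 2) * d = e" using C(1) by (simp add: d_def)
    then have d_sum: "d + d + C * d = e" by (simp add: algebra_simps)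
    obtain u' v' where uv': "(u', v') \<in> synthesis c" and close: "?n (\<lambda>x. u x - u' x) < d" "?n (\<lambda>x. v x - v' x) < d"
      using uv d unfolding L2_closure_def by blast
    then have u': "u' \<in> L2 torus" and v': "v' \<in> L2 torus" using synthesis_L2 by auto
    have "((\<lambda>F. ?n (\<lambda>\<theta>. v' \<theta> - S (torus_Fourier u') F \<theta>)) \<longlongrightarrow> 0) (finite_subsets_at_top UNIV)"
      using uv' by (simp add: synthesis_def L2_has_sum_def S_def)
    then have "\<forall>\<^sub>F F in finite_subsets_at_top UNIV. ?n (\<lambda>\<theta>. v' \<theta> - S (torus_Fourier u') F \<theta>) < d"
      using d by (rule order_tendstoD)
    moreover have "\<forall>\<^sub>F F in finite_subsets_at_top UNIV. finite F"
      by (rule eventually_finite_subsets_at_top_weakI)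
    ultimately show "\<forall>\<^sub>F F in finite_subsets_at_top UNIV. ?n (\<lambda>\<theta>. v \<theta> - S (torus_Fourier u) F \<theta>) < e"
    proof eventually_elim
      case (elim F)
      define a where "a k = torus_Fourier u' k - torus_Fourier u k" for k
      have u'u: "(\<lambda>\<theta>. u' \<theta> - u \<theta>) \<in> L2 torus" by (intro L2_diff u u')
      have "(?n (trig_sum a F))\<^sup>2 \<le> (?n (\<lambda>\<theta>. u' \<theta> - u \<theta>))\<^sup>2"
        using Bessel_inequality[OF u'u elim(2)] by (simp add: trig_sum_norm[OF elim(2)] a_def torus_Fourier_diff u u')
      then have trig: "?n (trig_sum a F) \<le> ?n (\<lambda>\<theta>. u \<theta> - u' \<theta>)"
        by (subst L2_norm_minus_commute) (rule power2_le_imp_le, auto)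
      have "(\<lambda>\<theta>. S (torus_Fourier u') F \<theta> - S (torus_Fourier u) F \<theta>) = (\<lambda>\<theta>. \<Sum>k\<in>F. c k \<theta> * a k)"
        by (simp add: S_def a_def sum_subtractf right_diff_distrib)
      then have "?n (\<lambda>\<theta>. S (torus_Fourier u') F \<theta> - S (torus_Fourier u) F \<theta>) \<le> C * ?n (trig_sum a F)"
        using C(2)[OF synthesis_trig_sum[OF c elim(2)]] by simp
      also have "\<dots> \<le> C * d"
        using trig close(1) C(1) by (intro mult_left_mono) auto
      finally have "?n (\<lambda>\<theta>. S (torus_Fourier u') F \<theta> - S (torus_Fourier u) F \<theta>) \<le> C * d" .
      then show ?case
        using L2_norm_diff_triangle[OF v v' S, of "torus_Fourier u" F]
          L2_norm_diff_triangle[OF v' S S, of "torus_Fourier u" F "torus_Fourier u'" F] close(2) elim(1) d_sum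
        by simp
    qed
  next
    fix e :: real assume "e < 0"
    then show "\<forall>\<^sub>F F in finite_subsets_at_top UNIV. e < ?n (\<lambda>\<theta>. v \<theta> - S (torus_Fourier u) F \<theta>)"
      by (intro always_eventually allI less_le_trans[OF _ L2_norm_nonneg])
  qed
  then show "(u, v) \<in> synthesis c"
    using u v c' by (simp add: synthesis_def L2_has_sum_def S_def)
next
  fix u v assume uv: "(u, v) \<in> synthesis c"
  then have "u \<in> L2 torus" "v \<in> L2 torus" using synthesis_L2 by auto
  then show "(u, v) \<in> L2_closure torus (synthesis c)"
    using uv by (intro L2_closureI_sequence[of u torus v "\<lambda>_. u" "\<lambda>_. v"]) (auto simp: L2_norm_def)
qed

section \<open>Semi-classical and toroidal operators\<close>

lemma torus_exp_mult_L2: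
  assumes "f \<in> L2 torus"
  shows "(\<lambda>\<theta>. torus_exp k \<theta> * f \<theta>) \<in> L2 torus"
  using assms by (auto simp: L2_def norm_mult)

lemma toroidal_Op_eq_synthesis:
  "toroidal_Op \<tau> = synthesis (\<lambda>k \<theta>. torus_exp k \<theta> * \<tau> \<theta> k)"
  unfolding toroidal_Op_def synthesis_def torus_exp_def ..

text \<open>By the sign of \<open>lattice_point\<close> the integrand at the k-th point is
  \<open>u * cnj (c k)\<close>. A product of two L2 functions is integrable, which supplies the
  integrability demanded by the definition.\<close>

lemma semiclassical_Op_iff:
  assumes h: "h > 0" and c: "\<And>k. c k \<in> L2 torus"
    and c_def: "\<And>k \<theta>. c k \<theta> = torus_exp k \<theta> * cnj (\<sigma> (lattice_point h k) \<theta>)"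
  shows "(f, g) \<in> semiclassical_Op h \<sigma> \<longleftrightarrow> g \<in> L2 (lattice_measure h) \<and>
    (\<exists>u. (f, u) \<in> hFourier h \<and> (\<forall>k. L2_inner torus u (c k) = g (lattice_point h k)))"
proof -
  have integrand: "cis (2 * pi / h * (lattice_point h k \<bullet> \<theta>)) * \<sigma> (lattice_point h k) \<theta> * u \<theta> = u \<theta> * cnj (c k \<theta>)"
    for k u \<theta>
    unfolding cis_lattice_point(2)[OF h] c_def by simp
  have "(\<forall>q\<in>hlattice h. integrable torus (\<lambda>\<theta>. cis (2 * pi / h * (q \<bullet> \<theta>)) * \<sigma> q \<theta> * u \<theta>) \<and>
      g q = (LINT \<theta>|torus. cis (2 * pi / h * (q \<bullet> \<theta>)) * \<sigma> q \<theta> * u \<theta>)) \<longleftrightarrow>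
      (\<forall>k. L2_inner torus u (c k) = g (lattice_point h k))" if "(f, u) \<in> hFourier h" for u
    unfolding ball_hlattice[OF h] integrand L2_inner_def[symmetric]
    using L2_integrable_mult_cnj[OF hFourier_L2(2)[OF h that] c] by auto
  then show ?thesis
    unfolding semiclassical_Op_def by auto
qed

text \<open>A square-summable \<open>g\<close> is the coefficient family of some \<open>w\<close>,
  and the values (u, c_k) of the operator are then the coefficients that make \<open>(u, w)\<close>
  a pair of the adjoint. Square-summability of the output thus matches the domain of the
  adjoint.\<close>

lemma semiclassical_Op_eq:
  assumes h: "h > 0" and c: "\<And>k. c k \<in> L2 torus"
    and c_def: "\<And>k \<theta>. c k \<theta> = torus_exp k \<theta> * cnj (\<sigma> (lattice_point h k) \<theta>)"
  shows "semiclassical_Op h \<sigma> = hFourier h O L2_adjoint torus (synthesis c) O hFourier_inv h"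
proof (intro antisym subrelI)
  fix f g assume "(f, g) \<in> semiclassical_Op h \<sigma>"
  then obtain u where g: "g \<in> L2 (lattice_measure h)" and fu: "(f, u) \<in> hFourier h"
    and u: "\<And>k. L2_inner torus u (c k) = g (lattice_point h k)"
    using semiclassical_Op_iff[where c = c and \<sigma> = \<sigma>, OF h c c_def] by blast
  obtain w where w: "(g, w) \<in> hFourier h"
    using hFourier_ex_image[OF h g] .
  have "(u, w) \<in> L2_adjoint torus (synthesis c)" "(w, g) \<in> hFourier_inv h"
    using u w hFourier_L2(2)[OF h fu]
    by (simp_all add: synthesis_adjoint_iff[OF c] hFourier_iff[OF h] hFourier_inv_iff[OF h])
  with fu show "(f, g) \<in> hFourier h O L2_adjoint torus (synthesis c) O hFourier_inv h"
    by blast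
next
  fix f g assume "(f, g) \<in> hFourier h O L2_adjoint torus (synthesis c) O hFourier_inv h"
  then obtain u w where fu: "(f, u) \<in> hFourier h" and uw: "(u, w) \<in> L2_adjoint torus (synthesis c)"
    and wg: "(w, g) \<in> hFourier_inv h"
    by blast
  have "g \<in> L2 (lattice_measure h)" using wg by (simp add: hFourier_inv_def)
  moreover have "L2_inner torus u (c k) = g (lattice_point h k)" for k
    using uw wg by (simp add: synthesis_adjoint_iff[OF c] hFourier_inv_iff[OF h])
  ultimately show "(f, g) \<in> semiclassical_Op h \<sigma>"
    using fu semiclassical_Op_iff[where c = c and \<sigma> = \<sigma>, OF h c c_def] by blast
qed

text \<open>Unitary conjugation commutes with adjoints: every L2 function has a partner under the
  transform, and inner products are preserved. With \<open>A\<close> itself an adjoint, this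
  produces the double adjoint.\<close>

lemma hFourier_conjugate_adjoint:
  fixes A :: "(real ^ 'n) L2_op"
  assumes h: "h > 0" and A: "A \<subseteq> L2 torus \<times> L2 torus"
  shows "hFourier_inv h O L2_adjoint (lattice_measure h) (hFourier h O A O hFourier_inv h) O hFourier h
    = L2_adjoint torus A"
proof -
  have inv: "(u, f) \<in> hFourier_inv h \<longleftrightarrow> (f, u) \<in> hFourier h" for u :: "real ^ 'n \<Rightarrow> complex" and f
    by (simp add: hFourier_iff[OF h] hFourier_inv_iff[OF h])
  note inner = hFourier_inner[OF h]
  show ?thesis
  proof (intro antisym subrelI)
    fix u v :: "real ^ 'n \<Rightarrow> complex"
    assume "(u, v) \<in> hFourier_inv h O L2_adjoint (lattice_measure h) (hFourier h O A O hFourier_inv h) O hFourier h"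
    then obtain f g where fu: "(f, u) \<in> hFourier h" and gv: "(g, v) \<in> hFourier h"
      and fg: "(f, g) \<in> L2_adjoint (lattice_measure h) (hFourier h O A O hFourier_inv h)"
      unfolding relcomp_unfold inv by blast
    have "L2_inner torus y u = L2_inner torus x v" if xy: "(x, y) \<in> A" for x y
    proof -
      obtain p where p: "(p, x) \<in> hFourier h" using hFourier_ex_preimage[OF h] xy A by blast
      obtain q where q: "(q, y) \<in> hFourier h" using hFourier_ex_preimage[OF h] xy A by blast
      have "(p, q) \<in> hFourier h O A O hFourier_inv h" using p q xy inv by blast
      then have "L2_inner (lattice_measure h) q f = L2_inner (lattice_measure h) p g"
        using fg unfolding L2_adjoint_def by blast
      then show ?thesis by (simp add: inner[OF q fu] inner[OF p gv])
    qed
    then show "(u, v) \<in> L2_adjoint torus A"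
      using hFourier_L2(2)[OF h fu] hFourier_L2(2)[OF h gv] by (auto simp: L2_adjoint_def)
  next
    fix u v :: "real ^ 'n \<Rightarrow> complex"
    assume uv: "(u, v) \<in> L2_adjoint torus A"
    then have "u \<in> L2 torus" "v \<in> L2 torus" by (auto simp: L2_adjoint_def)
    then obtain f g where fu: "(f, u) \<in> hFourier h" and gv: "(g, v) \<in> hFourier h"
      using hFourier_ex_preimage[OF h] by metis
    have "L2_inner (lattice_measure h) q f = L2_inner (lattice_measure h) p g"
      if "(p, q) \<in> hFourier h O A O hFourier_inv h" for p q
    proof -
      obtain x y where p: "(p, x) \<in> hFourier h" and q: "(q, y) \<in> hFourier h" and "(x, y) \<in> A"
        using \<open>(p, q) \<in> hFourier h O A O hFourier_inv h\<close> inv by blast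
      then have "L2_inner torus y u = L2_inner torus x v"
        using uv unfolding L2_adjoint_def by blast
      then show ?thesis by (simp add: inner[OF q fu] inner[OF p gv])
    qed
    then have "(f, g) \<in> L2_adjoint (lattice_measure h) (hFourier h O A O hFourier_inv h)"
      using hFourier_L2(1)[OF h fu] hFourier_L2(1)[OF h gv] by (auto simp: L2_adjoint_def)
    with fu gv show "(u, v) \<in> hFourier_inv h O L2_adjoint (lattice_measure h) (hFourier h O A O hFourier_inv h) O hFourier h"
      using inv by blast
  qed
qed

theorem theorem5p2:
  fixes h :: real
    and \<sigma> :: "real ^ 'n \<Rightarrow> real ^ 'n \<Rightarrow> complex"
    and \<tau> :: "real ^ 'n \<Rightarrow> int ^ 'n \<Rightarrow> complex"
  assumes "0 < h" and "h \<le> 1"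
    and "\<And>k. k \<in> hlattice h \<Longrightarrow> \<sigma> k \<in> L2 torus"
    and "\<And>\<theta> k. \<tau> \<theta> k = cnj (\<sigma> (- (h *\<^sub>R zvec k)) \<theta>)"
  shows "semiclassical_Op h \<sigma> = hFourier h O L2_adjoint torus (toroidal_Op \<tau>) O hFourier_inv h
    \<and> L2_closure torus (toroidal_Op \<tau>) =
        hFourier_inv h O L2_adjoint (lattice_measure h) (semiclassical_Op h \<sigma>) O hFourier h
    \<and> (L2_bounded torus (toroidal_Op \<tau>) \<longrightarrow>
        toroidal_Op \<tau> =
        hFourier_inv h O L2_adjoint (lattice_measure h) (semiclassical_Op h \<sigma>) O hFourier h)"
proof -
  define c where "c k \<theta> = torus_exp k \<theta> * \<tau> \<theta> k" for k \<theta>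
  have c_eq: "c k \<theta> = torus_exp k \<theta> * cnj (\<sigma> (lattice_point h k) \<theta>)" for k \<theta>
    by (simp add: c_def assms(4) lattice_point_def)
  have "lattice_point h k \<in> hlattice h" for k :: "int ^ 'n"
    using bij_betw_lattice_point[OF assms(1)] by (rule bij_betwE[rule_format]) simp
  \<comment> \<open>Exponentials have modulus 1, so square-integrability of the symbol in \<theta>
    passes to the columns.\<close>
  then have c: "c k \<in> L2 torus" for k
    unfolding c_eq[abs_def] by (intro torus_exp_mult_L2 L2_cnj assms(3))
  have T: "toroidal_Op \<tau> = synthesis c"
    unfolding c_def[abs_def] by (rule toroidal_Op_eq_synthesis)
  have S: "semiclassical_Op h \<sigma> = hFourier h O L2_adjoint torus (synthesis c) O hFourier_inv h"
    by (rule semiclassical_Op_eq[OF assms(1) c c_eq])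
  have "hFourier_inv h O L2_adjoint (lattice_measure h) (semiclassical_Op h \<sigma>) O hFourier h
      = L2_closure torus (synthesis c)"
    unfolding S synthesis_closure[OF c, symmetric]
    by (rule hFourier_conjugate_adjoint[OF assms(1)]) (auto simp: L2_adjoint_def)
  then show ?thesis
    unfolding T using S synthesis_closed_if_bounded[OF c] by simp
qed

end
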